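(* Let $H:\mathbb{R}^n\to\mathbb{R}$ be convex with $H(0)=\min_{\mathbb{R}^n}H=0$ and such that $\{p:H(p)=0\}$ is bounded and has empty interior. Let $U\subset\mathbb{R}^n$ be a bounded open set and let $u,v\in C(\bar U)$ be such that $u$ is absolutely subminimizing for $H$ in $U$ and $v$ is absolutely superminimizing for $H$ in $U$. Then $$u(x)-v(x)\le \max_{y\in\partial U}\,(u(y)-v(y))\quad\text{for every } x\in U.$$
   Context: $V\ll U$ means that $V$ is open and $\bar V$ is a compact subset of $U$. $\mathrm{Lip}_{\mathrm{loc}}(U)$ is the set of functions $U\to\mathbb{R}$ that are Lipschitz continuous on every $V\ll U$; for $v\in \mathrm{Lip}_{\mathrm{loc}}(U)$, $Dv$ is its almost everywhere defined gradient and $\|H(Dv)\|_{L^\infty(U)}:=\operatorname{ess\,sup}_{x\in U}H(Dv(x))\in[0,\infty]$. A function $u\in\mathrm{Lip}_{\mathrm{loc}}(U)$ is absolutely subminimizing (respectively, absolutely superminimizing) for $H$ in $U$ if, whenever $V\ll U$ and $w\in \mathrm{Lip}_{\mathrm{loc}}(V)\cap C(\bar V)$ satisfy $w=u$ on $\partial V$ and $u\ge w$ in $V$ (respectively, $u\le w$ in $V$), one has $\|H(Du)\|_{L^\infty(V)}\le\|H(Dw)\|_{L^\infty(V)}$. *)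

theory Defs
  imports "HOL-Analysis.Analysis" "HOL-Probability.Essential_Supremum"
begin

definition compactly_contained :: "(real ^ 'n) set \<Rightarrow> (real ^ 'n) set \<Rightarrow> bool"  (infix "\<lless>" 50)
  where "V \<lless> U \<longleftrightarrow> open V \<and> compact (closure V) \<and> closure V \<subseteq> U"

definition Lip_loc :: "(real ^ 'n) set \<Rightarrow> (real ^ 'n \<Rightarrow> real) set"
  where "Lip_loc U = {f. \<forall>V. V \<lless> U \<longrightarrow> (\<exists>L. L-lipschitz_on V f)}"

text \<open>The value of the gradient is unspecified at points where the function is not differentiable;
  for a function in \<open>Lip_loc U\<close> with \<open>U\<close> open, these form a null subset of \<open>U\<close>, which the
  essential supremum below ignores.\<close>

definition grad :: "(real ^ 'n \<Rightarrow> real) \<Rightarrow> real ^ 'n \<Rightarrow> real ^ 'n"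
  where "grad f x = (THE D. GDERIV f x :> D)"

lemma grad_eqI:
  assumes "GDERIV f x :> D"
  shows "grad f x = D"
  unfolding grad_def
proof (rule the_equality[where P = "\<lambda>D. GDERIV f x :> D", OF assms])
  fix D' assume "GDERIV f x :> D'"
  then have "(\<lambda>h. h \<bullet> D') = (\<lambda>h. h \<bullet> D)"
    using assms unfolding gderiv_def by (rule has_derivative_unique)
  then show "D' = D"
    by (metis vector_eq_ldot)
qed

text \<open>The norm of \<open>H(Df)\<close> in \<open>L\<^sup>\<infinity>(V)\<close> for a nonnegative \<open>H\<close>. Taking the essential supremum in
  \<^typ>\<open>ennreal\<close> gives a value in \<open>[0, \<infinity>]\<close>, namely \<open>0\<close> if \<open>V\<close> is empty.\<close>

definition Linf_H_grad :: "(real ^ 'n \<Rightarrow> real) \<Rightarrow> (real ^ 'n) set \<Rightarrow> (real ^ 'n \<Rightarrow> real) \<Rightarrow> ennreal"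
  where "Linf_H_grad H V f = esssup (lebesgue_on V) (\<lambda>x. ennreal (H (grad f x)))"

text \<open>Functions on \<open>U\<close> or \<open>closure V\<close> are represented by total functions, of which only the
  values on that set matter.\<close>

definition absolutely_subminimizing ::
    "(real ^ 'n \<Rightarrow> real) \<Rightarrow> (real ^ 'n) set \<Rightarrow> (real ^ 'n \<Rightarrow> real) \<Rightarrow> bool"
  where "absolutely_subminimizing H U u \<longleftrightarrow> u \<in> Lip_loc U \<and>
    (\<forall>V w. V \<lless> U \<longrightarrow> w \<in> Lip_loc V \<longrightarrow> continuous_on (closure V) w \<longrightarrow>
       (\<forall>x\<in>frontier V. w x = u x) \<longrightarrow> (\<forall>x\<in>V. u x \<ge> w x) \<longrightarrow>
       Linf_H_grad H V u \<le> Linf_H_grad H V w)"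

definition absolutely_superminimizing ::
    "(real ^ 'n \<Rightarrow> real) \<Rightarrow> (real ^ 'n) set \<Rightarrow> (real ^ 'n \<Rightarrow> real) \<Rightarrow> bool"
  where "absolutely_superminimizing H U u \<longleftrightarrow> u \<in> Lip_loc U \<and>
    (\<forall>V w. V \<lless> U \<longrightarrow> w \<in> Lip_loc V \<longrightarrow> continuous_on (closure V) w \<longrightarrow>
       (\<forall>x\<in>frontier V. w x = u x) \<longrightarrow> (\<forall>x\<in>V. u x \<le> w x) \<longrightarrow>
       Linf_H_grad H V u \<le> Linf_H_grad H V w)"

end

theory Submission
  imports Defs
begin

text \<open>Let \<open>c\<^sub>t x y = t * L ((y - x) / t)\<close> with \<open>L\<close> the Legendre transform of \<open>H\<close> made
  infinite for large gradients, and let \<open>T\<^sub>t w x = SUP y. w y - c\<^sub>t x y\<close> be the Hopf-Lax semigroup. Comparison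
  with the cones given by the support functions of \<open>{H \<le> l}\<close> shows that \<open>t \<mapsto> T\<^sub>t u x\<close> is midpoint
  convex at \<open>0\<close> for a subminimizing \<open>u\<close>, so that \<open>w = T\<^sub>t u\<close> has nonnegative second
  difference with respect to \<open>T\<^sub>t\<close> and its lower counterpart; dually for \<open>v\<close>. The two discrete
  inequalities are compared by the method of Armstrong and Smart, once \<open>w\<close> has been
  modified where it is flat so that \<open>T\<^sub>t w - w\<close> is bounded below by a positive constant. The
  modification is uniformly small because \<open>{H = 0}\<close> lies in a hyperplane, so that one can leave \<open>U\<close>
  at little cost along its normal. Differentiability almost everywhere of Lipschitz functions is
  needed to pass between the essential supremum of \<open>H (Du)\<close> and increments of \<open>u\<close>.\<close>

section \<open>Rademacher's theorem\<close>

text \<open>\<open>H\<close> need not be differentiable or strictly convex and \<open>u\<close> has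
  a gradient only almost everywhere, so nothing can be evaluated at a maximum of
  \<open>u - v\<close>. The Hopf-Lax step replaces gradients by increments over a finite distance.
  Cutting the Hamiltonian off at level \<open>m\<close> makes the cost finite and Lipschitz. On a
  compactly contained set \<open>u\<close> has slopes at most \<open>K\<close>; letting
  \<open>l\<close> bound \<open>H\<close> on the ball of radius \<open>K + 1\<close> makes the cost
  outgrow \<open>u\<close>, so suprema are nearly attained close by, and the gap of 1 between
  \<open>l\<close> and \<open>m\<close> leaves room to perturb maximizers. At a near-maximum of
  \<open>w - z\<close> the two discrete inequalities only show that a near-optimal step for
  \<open>w\<close> ends at another near-maximum, which is contradictory only if \<open>w\<close>
  rises by a definite amount. The parameters have a fixed order: first \<open>t\<close>, with an
  error \<open>2 * t * l\<close>, then, for that \<open>t\<close>, the drift speed and the growth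
  gap. Leaving \<open>I\<close> with steps of length \<open>r\<close> takes about
  \<open>2 * b / r\<close> steps, each of cost at most \<open>r * \<eta>\<close> each way, so the
  total is of order \<open>b * \<eta>\<close> however slow the drift.\<close>

text \<open>Adding a linear function of slope \<open>L + 1\<close> makes \<open>g\<close> strictly
  increasing with slope at least 1, hence invertible. Its Stieltjes measure has a Radon-Nikodym
  density, which is the derivative up to that constant. Only the right derivative results because
  the differentiation theorem used averages over intervals starting at the point.\<close>

lemma lipschitz_real_AE_derivative_right:
  fixes g :: "real \<Rightarrow> real"
  assumes lip: "L-lipschitz_on UNIV g"
  obtains h N where "negligible N"
    "\<And>a b. a \<le> b \<Longrightarrow> (h has_integral (g b - g a)) {a..b}"
    "\<And>t. t \<notin> N \<Longrightarrow> (g has_real_derivative h t) (at_right t)"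
proof -
  define G where "G = (\<lambda>t. g t + (L + 1) * t)"
  have L0: "0 \<le> L" using lip by (rule lipschitz_on_nonneg)
  have gl: "\<bar>g s - g t\<bar> \<le> L * \<bar>s - t\<bar>" for s t
    using lipschitz_on_normD[OF lip, of s t] by simp
  have Gexp: "t - s \<le> G t - G s" if "s \<le> t" for s t
    using gl[of t s] that unfolding G_def by (simp add: algebra_simps abs_le_iff)
  have Glip: "\<bar>G s - G t\<bar> \<le> (2 * L + 1) * \<bar>s - t\<bar>" for s t
  proof -
    have "G s - G t = (g s - g t) + (L + 1) * (s - t)"
      by (simp add: G_def algebra_simps)
    then have "\<bar>G s - G t\<bar> \<le> \<bar>g s - g t\<bar> + (L + 1) * \<bar>s - t\<bar>"
      using L0 by (metis abs_mult abs_of_nonneg abs_triangle_ineq add_increasing2 zero_le_one)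
    with gl[of s t] show ?thesis by (simp add: algebra_simps)
  qed
  have sm: "strict_mono G"
  proof (rule strict_monoI)
    fix x y :: real assume "x < y" then show "G x < G y" using Gexp[of x y] by linarith
  qed
  have contG: "continuous_on UNIV G"
    by (rule lipschitz_on_continuous_on[of "2*L+1"], rule lipschitz_onI)
      (use Glip L0 in \<open>auto simp: dist_real_def\<close>)
  have surj: "\<exists>t. G t = y" for y
  proof -
    let ?c = "\<bar>y - G 0\<bar>"
    have "G (-?c) \<le> y" using Gexp[of "-?c" 0] by linarith
    moreover have "y \<le> G ?c" using Gexp[of 0 ?c] by linarith
    ultimately show ?thesis
      using IVT'[of G "-?c" y ?c] continuous_on_subset[OF contG] by fastforce
  qed
  define K where "K = inv G"
  have GK: "G (K y) = y" for y using surj unfolding K_def by (metis f_inv_into_f rangeI)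
  have KG: "K (G t) = t" for t unfolding K_def by (simp add: strict_mono_imp_inj_on sm)
  have Gle: "G s \<le> G t \<longleftrightarrow> s \<le> t" for s t using sm by (simp add: strict_mono_less_eq)
  have monoK: "mono K" by (rule monoI) (metis GK Gle)
  have [measurable]: "K \<in> borel_measurable borel" by (rule borel_measurable_mono[OF monoK])
  \<comment> \<open>\<open>M A\<close> is the measure of \<open>G ` A\<close>; it is absolutely continuous because \<open>G\<close> is Lipschitz.\<close>
  define M where "M = distr lborel borel K"
  have ac: "absolutely_continuous lborel M"
    unfolding absolutely_continuous_def
  proof
    fix A :: "real set" assume A: "A \<in> null_sets lborel"
    then have Ab: "A \<in> sets borel" by auto
    have "negligible A" using A by (metis negligible_iff_null_sets null_sets_completionI)
    then have "negligible (G ` A)"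
    proof (rule negligible_locally_Lipschitz_image[OF order_refl])
      fix x assume "x \<in> A"
      show "\<exists>T B. open T \<and> x \<in> T \<and> (\<forall>y\<in>A \<inter> T. norm (G y - G x) \<le> B * norm (y - x))"
        using Glip by (intro exI[of _ UNIV] exI[of _ "2*L+1"]) auto
    qed
    moreover have "G ` A = K -` A"
    proof safe
      fix x assume "K x \<in> A" then show "x \<in> G ` A" using GK[of x] by (metis imageI)
    qed (simp add: KG)
    ultimately have "K -` A \<in> null_sets lborel"
      using Ab measurable_sets_borel[OF \<open>K \<in> borel_measurable borel\<close> Ab]
      by (metis negligible_iff_null_sets null_sets_completion_iff sets_lborel)
    then show "A \<in> null_sets M"
      using Ab by (auto simp: null_sets_def M_def emeasure_distr)
  qed
  obtain f where f[measurable]: "f \<in> borel_measurable lborel" and fM: "density lborel f = M"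
    using sigma_finite_measure.Radon_Nikodym[OF lborel.sigma_finite_measure_axioms ac]
    by (auto simp: M_def)
  have f_Icc: "(\<integral>\<^sup>+x. f x * indicator {a..b} x \<partial>lborel) = ennreal (G b - G a)" if "a \<le> b" for a b
  proof -
    have "(\<integral>\<^sup>+x. f x * indicator {a..b} x \<partial>lborel) = emeasure M {a..b}"
      by (simp add: fM[symmetric] emeasure_density)
    also have "\<dots> = emeasure lborel (K -` {a..b})" by (simp add: M_def emeasure_distr)
    also have "K -` {a..b} = {G a..G b}"
      by (auto, (metis GK Gle)+)
    finally show ?thesis using that by (simp add: Gle)
  qed
  define F where "F = (\<lambda>t. enn2real (f t))"
  have [measurable]: "F \<in> borel_measurable borel" using f unfolding F_def by simp
  have FI: "(F has_integral (G b - G a)) {a..b}" if ab: "a \<le> b" for a b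
  proof -
    have fin: "AE x in lborel. f x * indicator {a..b} x \<noteq> \<infinity>"
      by (rule nn_integral_PInf_AE) (use f_Icc[OF ab] in auto)
    have eq: "(\<integral>\<^sup>+x. ennreal (indicator {a..b} x *\<^sub>R F x) \<partial>lborel) = ennreal (G b - G a)"
      unfolding f_Icc[OF ab, symmetric]
      by (rule nn_integral_cong_AE, use fin in eventually_elim)
        (auto simp: F_def indicator_def less_top)
    have int: "set_integrable lborel {a..b} F"
      unfolding set_integrable_def
      by (rule integrableI_nonneg) (use eq in \<open>auto simp: F_def\<close>)
    have "set_lebesgue_integral lborel {a..b} F = G b - G a"
      unfolding set_lebesgue_integral_def
      by (subst integral_eq_nn_integral) (use eq ab in \<open>auto simp: F_def Gle\<close>)
    with set_borel_integral_eq_integral[OF int] show ?thesis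
      by (metis has_integral_integrable_integral)
  qed
  define h where "h = (\<lambda>t. F t - (L + 1))"
  have hI: "(h has_integral (g b - g a)) {a..b}" if "a \<le> b" for a b
  proof -
    have "(h has_integral ((G b - G a) - (b - a) * (L + 1))) {a..b}"
      unfolding h_def using has_integral_diff[OF FI[OF that] has_integral_const_real[of "L+1" a b]] that
      by simp
    then show ?thesis by (simp add: G_def algebra_simps)
  qed
  have "h integrable_on cbox a b" for a b
    using hI[of a b] by (cases "a \<le> b") (auto simp: cbox_interval)
  then obtain N where N: "negligible N" and
    der: "\<And>x e. \<lbrakk>x \<notin> N; 0 < e\<rbrakk> \<Longrightarrow> \<exists>d>0. \<forall>k. 0 < k \<and> k < d \<longrightarrow>
        norm (integral (cbox x (x + k *\<^sub>R One)) h /\<^sub>R k ^ DIM(real) - h x) < e"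
    using integrable_ccontinuous_explicit by blast
  have der': "(g has_real_derivative h t) (at_right t)" if "t \<notin> N" for t
    unfolding has_field_derivative_iff
  proof (rule tendstoI)
    fix e :: real assume "0 < e"
    from der[OF that this] obtain d where d: "d > 0"
      "\<And>k. 0 < k \<Longrightarrow> k < d \<Longrightarrow> \<bar>integral {t..t + k} h / k - h t\<bar> < e"
      by (auto simp: cbox_interval divide_inverse_commute)
    show "\<forall>\<^sub>F y in at_right t. dist ((g y - g t) / (y - t)) (h t) < e"
      unfolding eventually_at_right_field
    proof (intro exI conjI allI impI)
      show "t < t + d" using d by simp
      fix y assume y: "t < y" "y < t + d"
      have "integral {t..y} h = g y - g t" using hI[of t y] y by (simp add: integral_unique)
      then show "dist ((g y - g t) / (y - t)) (h t) < e"
        using d(2)[of "y - t"] y by (simp add: dist_real_def)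
    qed
  qed
  show ?thesis by (rule that[OF N hI der'])
qed

lemma negligible_if_integrals_zero:
  fixes k :: "'a::euclidean_space \<Rightarrow> real"
  assumes "\<And>a b. (k has_integral 0) (cbox a b)"
  shows "negligible {x. k x \<noteq> 0}"
proof -
  have "k integrable_on cbox a b" for a b using assms by blast
  then obtain N where N: "negligible N" and
    der: "\<And>x e. \<lbrakk>x \<notin> N; 0 < e\<rbrakk> \<Longrightarrow> \<exists>d>0. \<forall>h. 0 < h \<and> h < d \<longrightarrow>
        norm (integral (cbox x (x + h *\<^sub>R One)) k /\<^sub>R h ^ DIM('a) - k x) < e"
    using integrable_ccontinuous_explicit by blast
  have "k x = 0" if x: "x \<notin> N" for x
  proof (rule ccontr)
    assume nz: "k x \<noteq> 0"
    obtain d where "d > 0" "\<And>h. 0 < h \<Longrightarrow> h < d \<Longrightarrow>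
        norm (integral (cbox x (x + h *\<^sub>R One)) k /\<^sub>R h ^ DIM('a) - k x) < \<bar>k x\<bar>"
      using der[OF x, of "\<bar>k x\<bar>"] nz by auto
    from this(2)[of "d/2"] this(1) show False
      using integral_unique[OF assms] by simp
  qed
  then have "{x. k x \<noteq> 0} \<subseteq> N" by blast
  with N show ?thesis by (rule negligible_subset)
qed

text \<open>The left derivative is the right derivative of the reflected function. The two densities
  integrate to the same increments, so they agree almost everywhere.\<close>

lemma lipschitz_real_AE_derivative:
  fixes g :: "real \<Rightarrow> real"
  assumes lip: "L-lipschitz_on UNIV g"
  obtains h N where "negligible N"
    "\<And>a b. a \<le> b \<Longrightarrow> (h has_integral (g b - g a)) {a..b}"
    "\<And>t. t \<notin> N \<Longrightarrow> (g has_real_derivative h t) (at t)"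
proof -
  obtain h1 N1 where 1: "negligible N1"
    "\<And>a b. a \<le> b \<Longrightarrow> (h1 has_integral (g b - g a)) {a..b}"
    "\<And>t. t \<notin> N1 \<Longrightarrow> (g has_real_derivative h1 t) (at_right t)"
    using lipschitz_real_AE_derivative_right[OF lip] by metis
  have "L-lipschitz_on UNIV (\<lambda>t. g (- t))"
  proof (rule lipschitz_onI)
    show "dist (g (- x)) (g (- y)) \<le> L * dist x y" for x y
      using lipschitz_onD[OF lip, of "- x" "- y"] by (simp add: dist_minus)
  qed (rule lipschitz_on_nonneg[OF lip])
  then obtain h2 N2 where 2: "negligible N2"
    "\<And>a b. a \<le> b \<Longrightarrow> (h2 has_integral (g (- b) - g (- a))) {a..b}"
    "\<And>t. t \<notin> N2 \<Longrightarrow> ((\<lambda>t. g (- t)) has_real_derivative h2 t) (at_right t)"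
    using lipschitz_real_AE_derivative_right by metis
  have h2': "((\<lambda>t. h2 (- t)) has_integral (g a - g b)) {a..b}" if "a \<le> b" for a b
    using has_integral_reflect_real[of "\<lambda>t. h2 (- t)" "g a - g b" b a] 2(2)[of "-b" "-a"] that by simp
  have "((\<lambda>t. h1 t + h2 (- t)) has_integral 0) (cbox a b)" for a b
  proof (cases "a \<le> b")
    case True
    from has_integral_add[OF 1(2) h2', OF this this] show ?thesis by (simp add: cbox_interval)
  qed (simp add: cbox_interval)
  from negligible_if_integrals_zero[OF this]
  have N3: "negligible {t. h1 t + h2 (- t) \<noteq> 0}" .
  have N2': "negligible (uminus ` N2)"
    by (rule negligible_locally_Lipschitz_image[OF order_refl 2(1)])
      (rule exI[of _ UNIV], rule exI[of _ 1], auto)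
  define N where "N = N1 \<union> uminus ` N2 \<union> {t. h1 t + h2 (- t) \<noteq> 0}"
  have der: "(g has_real_derivative h1 t) (at t)" if t: "t \<notin> N" for t
  proof -
    have r: "(g has_real_derivative h1 t) (at_right t)" using t 1(3) by (auto simp: N_def)
    have "- t \<notin> N2" using t by (force simp: N_def)
    note d2 = 2(3)[OF this]
    have "h2 (- t) = - h1 t" using t by (auto simp: N_def)
    with d2 have d2: "((\<lambda>t. g (- t)) has_real_derivative - h1 t) (at (- t) within {- t<..})" by simp
    have "uminus ` {..<t} = {- t<..}"
    proof safe
      fix s assume "- t < s" then show "s \<in> uminus ` {..<t}" by (intro image_eqI[of _ _ "- s"]) auto
    qed simp
    with d2 have "((\<lambda>t. g (- t)) has_real_derivative - h1 t) (at (- t) within uminus ` {..<t})"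
      by simp
    moreover have "(uminus has_real_derivative - 1) (at_left t)"
      by (auto intro!: derivative_eq_intros)
    ultimately have l: "(g has_real_derivative h1 t) (at_left t)"
      using DERIV_image_chain[of "\<lambda>t. g (- t)" "- h1 t" uminus t "{..<t}" "- 1"] by (simp add: o_def)
    show ?thesis
      using l r unfolding has_field_derivative_iff by (rule filterlim_split_at)
  qed
  show ?thesis
  proof (rule that[OF _ 1(2) der])
    show "negligible N" unfolding N_def using 1(1) N2' N3 by (intro negligible_Un)
  qed
qed

section \<open>Null sets and parallel lines\<close>

lemma AE_lborel_translate:
  fixes c :: "'a::euclidean_space"
  assumes [measurable]: "Measurable.pred borel P"
  shows "(AE x in lborel. P (c + x)) \<longleftrightarrow> (AE x in lborel. P x)"
proof -
  have "(AE x in lborel. P (c + x)) \<longleftrightarrow> (AE x in distr lborel borel ((+) c). P x)"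
    by (subst AE_distr_iff) auto
  then show ?thesis unfolding lborel_distr_plus .
qed

text \<open>Fubini: after the two quantifiers are exchanged, the inner condition no longer depends
  on \<open>t\<close> by translation invariance. From right to left, almost every line parallel to
  \<open>v\<close> meets a null set in a null set; from left to right, one-dimensional results
  become statements almost everywhere.\<close>

lemma AE_lborel_line_iff:
  fixes v :: "'a::euclidean_space"
  assumes [measurable]: "Measurable.pred borel P"
  shows "(AE x in lborel. AE t in (lborel :: real measure). P (t *\<^sub>R v + x)) \<longleftrightarrow> (AE x in lborel. P x)"
proof -
  have "(AE x in lborel. AE t in (lborel :: real measure). P (t *\<^sub>R v + x)) \<longleftrightarrow>
      (AE t in (lborel :: real measure). AE x in lborel. P (t *\<^sub>R v + x))"
    by (rule lborel_pair.AE_commute) measurable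
  also have "\<dots> \<longleftrightarrow> (AE t in (lborel :: real measure). AE x in lborel. P x)"
    by (simp add: AE_lborel_translate)
  also have "\<dots> \<longleftrightarrow> (AE x in lborel. P x)"
    unfolding eventually_const_iff ae_filter_eq_bot_iff by simp
  finally show ?thesis .
qed

lemma AE_lborel_negligible_iff: "(AE x in lborel. P x) \<longleftrightarrow> negligible {x. \<not> P x}"
  for P :: "'a::euclidean_space \<Rightarrow> bool"
  using completion.AE_iff_null_sets[of P lborel]
  by (simp add: AE_completion_iff negligible_iff_null_sets)

text \<open>Difference quotients along the scales \<open>(1/2) ^ n\<close> suffice for Rademacher's theorem: by the
  Lipschitz bound, convergence for a dense set of directions is uniform on the unit ball.\<close>

definition dyadic_quotient :: "('a::real_normed_vector \<Rightarrow> real) \<Rightarrow> nat \<Rightarrow> 'a \<Rightarrow> 'a \<Rightarrow> real"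
  where "dyadic_quotient f n v x = (f (x + (1/2) ^ n *\<^sub>R v) - f x) * 2 ^ n"

lemma dyadic_quotient_lipschitz:
  assumes "L-lipschitz_on UNIV f"
  shows "\<bar>dyadic_quotient f n v x - dyadic_quotient f n w x\<bar> \<le> L * norm (v - w)"
proof -
  have "\<bar>dyadic_quotient f n v x - dyadic_quotient f n w x\<bar>
      = \<bar>f (x + (1/2) ^ n *\<^sub>R v) - f (x + (1/2) ^ n *\<^sub>R w)\<bar> * 2 ^ n"
    unfolding dyadic_quotient_def by (simp add: left_diff_distrib[symmetric] abs_mult)
  also have "\<dots> \<le> (L * norm ((1/2) ^ n *\<^sub>R v - (1/2) ^ n *\<^sub>R w)) * 2 ^ n"
    using lipschitz_on_normD[OF assms, of "x + (1/2) ^ n *\<^sub>R v" "x + (1/2) ^ n *\<^sub>R w"]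
    by (intro mult_right_mono) auto
  also have "norm ((1/2) ^ n *\<^sub>R v - (1/2) ^ n *\<^sub>R w) = (1/2) ^ n * norm (v - w)"
    by (simp add: scaleR_diff_right[symmetric])
  finally show ?thesis by (simp add: power_divide)
qed

lemma dyadic_quotient_zero [simp]: "dyadic_quotient f n 0 x = 0"
  by (simp add: dyadic_quotient_def)

lemma dyadic_quotient_bound:
  assumes "L-lipschitz_on UNIV f"
  shows "\<bar>dyadic_quotient f n v x\<bar> \<le> L * norm v"
  using dyadic_quotient_lipschitz[OF assms, of n v x 0] by simp

lemma dyadic_quotient_measurable [measurable]:
  fixes f :: "'a::euclidean_space \<Rightarrow> real"
  assumes [measurable]: "f \<in> borel_measurable borel"
  shows "dyadic_quotient f n v \<in> borel_measurable borel"
  unfolding dyadic_quotient_def[abs_def] by measurable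

lemma lipschitz_borel_measurable:
  fixes f :: "'a::euclidean_space \<Rightarrow> real"
  assumes "L-lipschitz_on UNIV f"
  shows "f \<in> borel_measurable borel"
  by (rule borel_measurable_continuous_onI[OF lipschitz_on_continuous_on[OF assms]])

text \<open>On every line parallel to \<open>v\<close> the function is Lipschitz in one variable,
  hence differentiable at almost every parameter; Fubini does the rest.\<close>

lemma AE_dyadic_quotient_scale:
  fixes f :: "'a::euclidean_space \<Rightarrow> real"
  assumes lip: "L-lipschitz_on UNIV f"
  shows "AE x in lborel. \<exists>l. (\<lambda>n. dyadic_quotient f n v x) \<longlonglongrightarrow> l
    \<and> (\<lambda>n. dyadic_quotient f n (c *\<^sub>R v) x) \<longlonglongrightarrow> c * l"
proof -
  note [measurable] = lipschitz_borel_measurable[OF lip]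
  let ?q = "dyadic_quotient f"
  \<comment> \<open>Convergence is written as a Cauchy condition, without naming the limit, so that
    \<open>P\<close> is visibly a Borel predicate as Fubini demands.\<close>
  define P where "P x \<longleftrightarrow> Cauchy (\<lambda>n. ?q n v x) \<and> (\<lambda>n. ?q n (c *\<^sub>R v) x - c * ?q n v x) \<longlonglongrightarrow> 0" for x
  have [measurable]: "Measurable.pred borel P" unfolding P_def by measurable
  have "AE t in (lborel :: real measure). P (t *\<^sub>R v + x)" for x
  proof -
    define g where "g t = f (t *\<^sub>R v + x)" for t
    have "(L * norm v)-lipschitz_on UNIV g"
    proof (rule lipschitz_onI)
      fix s t :: real
      have "dist (g s) (g t) \<le> L * dist (s *\<^sub>R v + x) (t *\<^sub>R v + x)"
        unfolding g_def by (rule lipschitz_onD[OF lip]) auto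
      also have "dist (s *\<^sub>R v + x) (t *\<^sub>R v + x) = norm v * dist s t"
        by (simp add: dist_norm scaleR_diff_left[symmetric])
      finally show "dist (g s) (g t) \<le> L * norm v * dist s t" by (simp add: mult.assoc)
    qed (use lipschitz_on_nonneg[OF lip] in simp)
    then obtain h N where N: "negligible N" and
      der: "\<And>t. t \<notin> N \<Longrightarrow> (g has_real_derivative h t) (at t)"
      using lipschitz_real_AE_derivative by metis
    have "P (t *\<^sub>R v + x)" if t: "t \<notin> N" for t
    proof -
      have lim: "(\<lambda>n. ?q n (b *\<^sub>R v) (t *\<^sub>R v + x)) \<longlonglongrightarrow> b * h t" for b
      proof (cases "b = 0")
        case False
        have "(\<lambda>h. (g (t + h) - g t) / h) \<midarrow>0\<rightarrow> h t"
          using der[OF t] by (simp add: DERIV_def)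
        moreover have "filterlim (\<lambda>n. (1/2) ^ n * b) (at 0) sequentially"
          unfolding filterlim_at using False
          by (auto intro!: tendsto_mult_left_zero LIMSEQ_power_zero)
        ultimately have "(\<lambda>n. (g (t + (1/2) ^ n * b) - g t) / ((1/2) ^ n * b)) \<longlonglongrightarrow> h t"
          by (rule filterlim_compose)
        then have "(\<lambda>n. b * ((g (t + (1/2) ^ n * b) - g t) / ((1/2) ^ n * b))) \<longlonglongrightarrow> b * h t"
          by (intro tendsto_intros)
        moreover have "b * ((g (t + (1/2) ^ n * b) - g t) / ((1/2) ^ n * b)) = ?q n (b *\<^sub>R v) (t *\<^sub>R v + x)" for n
        proof -
          have "(t + (1/2) ^ n * b) *\<^sub>R v + x = (t *\<^sub>R v + x) + (1/2) ^ n *\<^sub>R (b *\<^sub>R v)"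
            by (simp add: algebra_simps)
          then have "?q n (b *\<^sub>R v) (t *\<^sub>R v + x) = (g (t + (1/2) ^ n * b) - g t) * 2 ^ n"
            by (simp only: g_def dyadic_quotient_def)
          then show ?thesis using False by (simp add: power_divide)
        qed
        ultimately show ?thesis by simp
      qed simp
      have "(\<lambda>n. ?q n (c *\<^sub>R v) (t *\<^sub>R v + x) - c * ?q n v (t *\<^sub>R v + x)) \<longlonglongrightarrow> c * h t - c * (1 * h t)"
        using lim[of c] lim[of 1] by (intro tendsto_intros) auto
      with lim[of 1] show ?thesis unfolding P_def
        by (auto intro: LIMSEQ_imp_Cauchy)
    qed
    then have "{t. \<not> P (t *\<^sub>R v + x)} \<subseteq> N" by blast
    with N show ?thesis unfolding AE_lborel_negligible_iff by (rule negligible_subset)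
  qed
  then have "AE x in lborel. P x"
    using AE_lborel_line_iff[of P v] by simp
  then show ?thesis
  proof eventually_elim
    case (elim x)
    then obtain l where l: "(\<lambda>n. ?q n v x) \<longlonglongrightarrow> l" unfolding P_def Cauchy_convergent_iff convergent_def by blast
    have "(\<lambda>n. (?q n (c *\<^sub>R v) x - c * ?q n v x) + c * ?q n v x) \<longlonglongrightarrow> 0 + c * l"
      using elim l unfolding P_def by (intro tendsto_intros) auto
    with l show ?case by auto
  qed
qed

lemma lborel_integral_translate:
  fixes F :: "'a::euclidean_space \<Rightarrow> real"
  assumes [measurable]: "F \<in> borel_measurable borel"
  shows "(\<integral>x. F (x + c) \<partial>lborel) = (\<integral>x. F x \<partial>lborel)"
proof -
  have "(\<integral>x. F x \<partial>distr lborel borel ((+) c)) = (\<integral>x. F (c + x) \<partial>lborel)"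
    by (subst integral_distr) auto
  then show ?thesis unfolding lborel_distr_plus by (simp add: add.commute)
qed

lemma integrable_indicator_cbox: "integrable lborel (indicator (cbox a b) :: 'a::euclidean_space \<Rightarrow> real)"
  unfolding integrable_indicator_iff using emeasure_lborel_cbox_finite[of a b] by simp

text \<open>Continuity of translations in the mean, by dominated convergence: off the boundary of
  the box, a null set, the indicator is locally constant.\<close>

lemma indicator_cbox_translate_tendsto:
  fixes v :: "'a::euclidean_space"
  shows "(\<lambda>n. \<integral>x. \<bar>indicator (cbox a b) (x - (1/2) ^ n *\<^sub>R v) - indicator (cbox a b) x\<bar> \<partial>lborel) \<longlonglongrightarrow> (0::real)"
proof -
  let ?i = "indicator (cbox a b) :: 'a \<Rightarrow> real"
  obtain R where R: "\<And>x. x \<in> cbox a b \<Longrightarrow> norm x \<le> R"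
    using bounded_cbox[of a b] by (auto simp: bounded_iff)
  obtain c where c: "cball 0 (R + norm v) \<subseteq> cbox (- c) (c :: 'a)"
    using bounded_subset_cbox_symmetric[OF bounded_cball] by blast
  have "(\<lambda>n. \<integral>x. \<bar>?i (x - (1/2) ^ n *\<^sub>R v) - ?i x\<bar> \<partial>lborel) \<longlonglongrightarrow> (\<integral>x. 0 \<partial>(lborel :: 'a measure))"
  proof (rule integral_dominated_convergence[where w = "indicator (cbox (- c) c)"])
    show "integrable lborel (indicator (cbox (- c) c) :: 'a \<Rightarrow> real)"
      by (rule integrable_indicator_cbox)
    have "AE x in lborel. x \<notin> cbox a b - box a b"
      unfolding AE_lborel_negligible_iff using negligible_frontier_interval[of a b]
      by (simp add: set_diff_eq)
    then show "AE x in lborel. (\<lambda>n. \<bar>?i (x - (1/2) ^ n *\<^sub>R v) - ?i x\<bar>) \<longlonglongrightarrow> 0"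
    proof eventually_elim
      case (elim x)
      have "(\<lambda>n. x - (1/2) ^ n *\<^sub>R v) \<longlonglongrightarrow> x - 0 *\<^sub>R v"
        by (intro tendsto_intros LIMSEQ_power_zero) auto
      then have lim: "(\<lambda>n. x - (1/2) ^ n *\<^sub>R v) \<longlonglongrightarrow> x" by simp
      consider "x \<in> box a b" | "x \<in> - cbox a b" using elim by blast
      then have "\<forall>\<^sub>F n in sequentially. \<bar>?i (x - (1/2) ^ n *\<^sub>R v) - ?i x\<bar> = 0"
      proof cases
        case 1
        from topological_tendstoD[OF lim open_box this] show ?thesis
          by eventually_elim (use 1 box_subset_cbox[of a b] in \<open>auto simp: indicator_def\<close>)
      next
        case 2
        from topological_tendstoD[OF lim open_Compl[OF closed_cbox] this] show ?thesis
          by eventually_elim (use 2 in auto)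
      qed
      then show ?case by (rule tendsto_eventually)
    qed
    show "AE x in lborel. norm \<bar>?i (x - (1/2) ^ n *\<^sub>R v) - ?i x\<bar> \<le> indicator (cbox (- c) c) x" for n
    proof (rule AE_I2)
      fix x
      have "norm x \<le> R + norm v" if "x - (1/2) ^ n *\<^sub>R v \<in> cbox a b"
      proof -
        have "norm x \<le> norm (x - (1/2) ^ n *\<^sub>R v) + norm ((1/2) ^ n *\<^sub>R v)"
          by (metis norm_triangle_ineq diff_add_cancel)
        also have "norm ((1/2) ^ n *\<^sub>R v) \<le> 1 * norm v"
          by (simp add: mult_left_le_one_le power_le_one)
        finally show ?thesis using R[OF that] by simp
      qed
      moreover have "norm x \<le> R + norm v" if "x \<in> cbox a b"
        using R[OF that] norm_ge_zero[of v] by linarith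
      ultimately show "norm \<bar>?i (x - (1/2) ^ n *\<^sub>R v) - ?i x\<bar> \<le> indicator (cbox (- c) c) x"
        using c by (auto simp: indicator_def subset_iff)
    qed
  qed auto
  then show ?thesis by simp
qed

text \<open>The additivity defect of the quotients converges almost everywhere by the
  one-dimensional result. Its limit is identified weakly: the integrals over boxes tend to 0, and
  since the defects are bounded, the limit has vanishing integrals as well. This plays the part of
  integration by parts against test functions.\<close>

lemma AE_dyadic_quotient_add:
  fixes f :: "'a::euclidean_space \<Rightarrow> real"
  assumes lip: "L-lipschitz_on UNIV f"
  shows "AE x in lborel. \<exists>l m. (\<lambda>n. dyadic_quotient f n v x) \<longlonglongrightarrow> l
    \<and> (\<lambda>n. dyadic_quotient f n w x) \<longlonglongrightarrow> m \<and> (\<lambda>n. dyadic_quotient f n (v + w) x) \<longlonglongrightarrow> l + m"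
proof -
  note [measurable] = lipschitz_borel_measurable[OF lip]
  have L0: "0 \<le> L" using lip by (rule lipschitz_on_nonneg)
  let ?q = "dyadic_quotient f"
  have conv: "AE x in lborel. convergent (\<lambda>n. ?q n z x)" for z
    using AE_dyadic_quotient_scale[OF lip, of z 1] by eventually_elim (auto simp: convergent_def)
  define e where "e n x = ?q n (v + w) x - ?q n v x - ?q n w x" for n x
  define E where "E x = lim (\<lambda>n. ?q n (v + w) x) - lim (\<lambda>n. ?q n v x) - lim (\<lambda>n. ?q n w x)" for x
  have [measurable]: "e n \<in> borel_measurable borel" for n unfolding e_def by measurable
  have [measurable]: "E \<in> borel_measurable borel" unfolding E_def by measurable
  have lims: "AE x in lborel. (\<lambda>n. e n x) \<longlonglongrightarrow> E x"
    using conv[of v] conv[of w] conv[of "v + w"] unfolding e_def E_def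
    by eventually_elim (auto intro!: tendsto_diff simp: convergent_LIMSEQ_iff)
  have e_shift: "e n x = ?q n w (x + (1/2) ^ n *\<^sub>R v) - ?q n w x" for n x
    by (simp add: e_def dyadic_quotient_def algebra_simps)
  have e_bound: "\<bar>e n x\<bar> \<le> 2 * L * norm w" for n x
    unfolding e_shift using dyadic_quotient_bound[OF lip, of n w x]
      dyadic_quotient_bound[OF lip, of n w "x + (1/2) ^ n *\<^sub>R v"] by linarith
  \<comment> \<open>By \<open>e_shift\<close>, the integral of \<open>e n\<close> over a box is the difference of the integrals of a
    bounded function over the box and over its translate by \<open>(1/2) ^ n *\<^sub>R v\<close>.\<close>
  have "(E has_integral 0) (cbox a b)" for a b
  proof -
    let ?i = "indicator (cbox a b) :: 'a \<Rightarrow> real"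
    note I = integrable_indicator_cbox[of a b]
    have dom: "integrable lborel (\<lambda>x. ?i x * E x)
      \<and> (\<lambda>n. \<integral>x. ?i x * e n x \<partial>lborel) \<longlonglongrightarrow> (\<integral>x. ?i x * E x \<partial>lborel)"
    proof (intro conjI)
      have w: "integrable lborel (\<lambda>x. ?i x * (2 * L * norm w))"
        using I by (rule integrable_mult_left)
      have c: "AE x in lborel. (\<lambda>n. ?i x * e n x) \<longlonglongrightarrow> ?i x * E x"
        using lims by eventually_elim (intro tendsto_intros)
      have b: "AE x in lborel. norm (?i x * e n x) \<le> ?i x * (2 * L * norm w)" for n
        using e_bound[of n] by (auto simp: indicator_def)
      show "integrable lborel (\<lambda>x. ?i x * E x)"
        by (rule integrable_dominated_convergence[OF _ _ w c b]) auto
      show "(\<lambda>n. \<integral>x. ?i x * e n x \<partial>lborel) \<longlonglongrightarrow> (\<integral>x. ?i x * E x \<partial>lborel)"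
        by (rule integral_dominated_convergence[OF _ _ w c b]) auto
    qed
    have small: "\<bar>\<integral>x. ?i x * e n x \<partial>lborel\<bar>
        \<le> L * norm w * (\<integral>x. \<bar>?i (x - (1/2) ^ n *\<^sub>R v) - ?i x\<bar> \<partial>lborel)" for n
    proof -
      let ?h = "(1/2) ^ n *\<^sub>R v"
      let ?p = "?q n w"
      have bnd: "\<bar>?p x\<bar> \<le> L * norm w" for x by (rule dyadic_quotient_bound[OF lip])
      have ip: "integrable lborel (\<lambda>x. ?i x * ?p (x + c))" for c
      proof (rule Bochner_Integration.integrable_bound)
        show "integrable lborel (\<lambda>x. ?i x * (L * norm w))"
          using I by (rule integrable_mult_left)
        show "AE x in lborel. norm (?i x * ?p (x + c)) \<le> norm (?i x * (L * norm w))"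
          by (rule AE_I2) (use bnd L0 in \<open>auto simp: indicator_def\<close>)
      qed measurable
      have "(\<lambda>x. ?i (x - ?h)) = indicator (cbox (a + ?h) (b + ?h))"
        by (auto simp: fun_eq_iff indicator_def mem_box inner_diff_left inner_add_left algebra_simps)
      then have I': "integrable lborel (\<lambda>x. ?i (x - ?h))"
        using integrable_indicator_cbox[of "a + ?h" "b + ?h"] by (simp only:)
      have ip': "integrable lborel (\<lambda>x. ?i (x - ?h) * ?p x)"
      proof (rule Bochner_Integration.integrable_bound)
        show "integrable lborel (\<lambda>x. ?i (x - ?h) * (L * norm w))"
          using I' by (rule integrable_mult_left)
        show "AE x in lborel. norm (?i (x - ?h) * ?p x) \<le> norm (?i (x - ?h) * (L * norm w))"
          by (rule AE_I2) (use bnd L0 in \<open>auto simp: indicator_def\<close>)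
      qed measurable
      have "(\<integral>x. ?i x * e n x \<partial>lborel) = (\<integral>x. ?i x * ?p (x + ?h) \<partial>lborel) - (\<integral>x. ?i x * ?p x \<partial>lborel)"
        using ip[of ?h] ip[of 0]
        by (simp add: e_shift right_diff_distrib Bochner_Integration.integral_diff)
      also have "(\<integral>x. ?i x * ?p (x + ?h) \<partial>lborel) = (\<integral>x. ?i (x - ?h) * ?p x \<partial>lborel)"
        using lborel_integral_translate[of "\<lambda>x. ?i (x - ?h) * ?p x" ?h] by simp
      also have "\<dots> - (\<integral>x. ?i x * ?p x \<partial>lborel) = (\<integral>x. (?i (x - ?h) - ?i x) * ?p x \<partial>lborel)"
        using ip' ip[of 0] by (simp add: left_diff_distrib Bochner_Integration.integral_diff)
      finally have eq: "(\<integral>x. ?i x * e n x \<partial>lborel) = (\<integral>x. (?i (x - ?h) - ?i x) * ?p x \<partial>lborel)" .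
      have "norm (\<integral>x. (?i (x - ?h) - ?i x) * ?p x \<partial>lborel)
          \<le> (\<integral>x. L * norm w * \<bar>?i (x - ?h) - ?i x\<bar> \<partial>lborel)"
      proof (rule Bochner_Integration.integral_norm_bound_integral)
        show "integrable lborel (\<lambda>x. (?i (x - ?h) - ?i x) * ?p x)"
          using ip' ip[of 0] by (simp add: left_diff_distrib)
        show "integrable lborel (\<lambda>x. L * norm w * \<bar>?i (x - ?h) - ?i x\<bar>)"
          using I I' by simp
        show "norm ((?i (x - ?h) - ?i x) * ?p x) \<le> L * norm w * \<bar>?i (x - ?h) - ?i x\<bar>" for x
          using mult_left_mono[OF bnd[of x], of "\<bar>?i (x - ?h) - ?i x\<bar>"] by (simp add: abs_mult mult.commute)
      qed
      then show ?thesis unfolding eq by simp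
    qed
    have "(\<lambda>n. \<integral>x. ?i x * e n x \<partial>lborel) \<longlonglongrightarrow> 0"
    proof (rule Lim_null_comparison)
      show "(\<lambda>n. L * norm w * (\<integral>x. \<bar>?i (x - (1/2) ^ n *\<^sub>R v) - ?i x\<bar> \<partial>lborel)) \<longlonglongrightarrow> 0"
        using tendsto_mult_left[OF indicator_cbox_translate_tendsto, of "L * norm w" a b v] by simp
      show "\<forall>\<^sub>F n in sequentially. norm (\<integral>x. ?i x * e n x \<partial>lborel)
          \<le> L * norm w * (\<integral>x. \<bar>?i (x - (1/2) ^ n *\<^sub>R v) - ?i x\<bar> \<partial>lborel)"
        using small by (intro always_eventually allI) (simp only: real_norm_def)
    qed
    from LIMSEQ_unique[OF conjunct2[OF dom] this] have "(\<integral>x. ?i x * E x \<partial>lborel) = 0" .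
    moreover have "set_integrable lborel (cbox a b) E"
      using dom by (simp add: set_integrable_def)
    ultimately show ?thesis
      using set_borel_integral_eq_integral[of "cbox a b" E]
      by (simp add: set_lebesgue_integral_def has_integral_iff)
  qed
  then have "negligible {x. E x \<noteq> 0}" by (rule negligible_if_integrals_zero)
  then have "AE x in lborel. E x = 0" by (simp add: AE_lborel_negligible_iff)
  then show ?thesis
    using conv[of v] conv[of w] conv[of "v + w"]
  proof eventually_elim
    case (elim x)
    then have "lim (\<lambda>n. ?q n (v + w) x) = lim (\<lambda>n. ?q n v x) + lim (\<lambda>n. ?q n w x)" by (simp add: E_def)
    with elim show ?case
      by (intro exI[of _ "lim (\<lambda>n. ?q n v x)"] exI[of _ "lim (\<lambda>n. ?q n w x)"])
        (simp add: convergent_LIMSEQ_iff)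
  qed
qed

lemma AE_dyadic_quotient_sum:
  fixes f :: "'a::euclidean_space \<Rightarrow> real"
  assumes lip: "L-lipschitz_on UNIV f" and "finite I"
  shows "AE x in lborel. (\<lambda>n. dyadic_quotient f n (\<Sum>i\<in>I. c i *\<^sub>R i) x)
    \<longlonglongrightarrow> (\<Sum>i\<in>I. c i * lim (\<lambda>n. dyadic_quotient f n i x))"
  using \<open>finite I\<close>
proof (induction I rule: finite_induct)
  case (insert i I)
  show ?case
    using insert.IH AE_dyadic_quotient_scale[OF lip, of i "c i"]
      AE_dyadic_quotient_add[OF lip, of "c i *\<^sub>R i" "\<Sum>i\<in>I. c i *\<^sub>R i"]
  proof eventually_elim
    case (elim x)
    then obtain l where l: "(\<lambda>n. dyadic_quotient f n i x) \<longlonglongrightarrow> l"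
      "(\<lambda>n. dyadic_quotient f n (c i *\<^sub>R i) x) \<longlonglongrightarrow> c i * l" by blast
    obtain l' m' where m: "(\<lambda>n. dyadic_quotient f n (c i *\<^sub>R i) x) \<longlonglongrightarrow> l'"
      "(\<lambda>n. dyadic_quotient f n (\<Sum>i\<in>I. c i *\<^sub>R i) x) \<longlonglongrightarrow> m'"
      "(\<lambda>n. dyadic_quotient f n (c i *\<^sub>R i + (\<Sum>i\<in>I. c i *\<^sub>R i)) x) \<longlonglongrightarrow> l' + m'"
      using elim(3) by blast
    have "(\<lambda>n. dyadic_quotient f n (c i *\<^sub>R i + (\<Sum>i\<in>I. c i *\<^sub>R i)) x)
        \<longlonglongrightarrow> c i * l + (\<Sum>i\<in>I. c i * lim (\<lambda>n. dyadic_quotient f n i x))"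
      using m(3) LIMSEQ_unique[OF m(1) l(2)] LIMSEQ_unique[OF m(2) elim(1)] by simp
    then show ?case using insert.hyps limI[OF l(1)] by simp
  qed
qed simp

theorem Rademacher:
  fixes f :: "'a::euclidean_space \<Rightarrow> real"
  assumes lip: "L-lipschitz_on UNIV f"
  obtains G where "G \<in> borel_measurable borel" "AE x in lborel. GDERIV f x :> G x"
proof -
  note [measurable] = lipschitz_borel_measurable[OF lip]
  have L0: "0 \<le> L" using lip by (rule lipschitz_on_nonneg)
  let ?q = "dyadic_quotient f"
  define D where "D x = (\<Sum>i\<in>Basis. lim (\<lambda>n. ?q n i x) *\<^sub>R i)" for x
  obtain S :: "'a set" where S: "countable S" "\<And>X. open X \<Longrightarrow> X \<noteq> {} \<Longrightarrow> \<exists>d\<in>S. d \<in> X"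
    using countable_dense_exists by metis
  have "AE x in lborel. \<forall>v\<in>S. (\<lambda>n. ?q n v x) \<longlonglongrightarrow> v \<bullet> D x"
    unfolding AE_ball_countable[OF S(1)]
  proof
    fix v assume "v \<in> S"
    show "AE x in lborel. (\<lambda>n. ?q n v x) \<longlonglongrightarrow> v \<bullet> D x"
      using AE_dyadic_quotient_sum[OF lip finite_Basis, of "\<lambda>i. v \<bullet> i"]
      by eventually_elim (simp add: euclidean_representation D_def inner_sum_right mult.commute)
  qed
  then have "AE x in lborel. GDERIV f x :> D x"
  proof eventually_elim
    case (elim x)
    have unif: "\<exists>N. \<forall>n\<ge>N. \<forall>v. norm v \<le> 1 \<longrightarrow> \<bar>?q n v x - v \<bullet> D x\<bar> \<le> e" if "e > 0" for e
    proof -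
      \<comment> \<open>A finite \<open>d\<close>-net of directions is enough: passing to the
        nearest net point changes the quotient and the linear form by at most \<open>e / 2\<close>
        together.\<close>
      define d where "d = (e / 2) / (L + norm (D x) + 1)"
      have pos: "L + norm (D x) + 1 > 0" using L0 by (simp add: add_nonneg_pos)
      then have d0: "d > 0" using that by (simp add: d_def)
      have sub: "cball 0 1 \<subseteq> (\<Union>s\<in>S. ball s d)"
      proof
        fix v :: 'a
        from S(2)[OF open_ball[of v d]] d0 obtain s where "s \<in> S" "s \<in> ball v d" by auto
        then show "v \<in> (\<Union>s\<in>S. ball s d)" by (auto simp: dist_commute)
      qed
      obtain F where F: "F \<subseteq> S" "finite F" "cball 0 1 \<subseteq> (\<Union>s\<in>F. ball s d)"
        by (rule compactE_image[OF compact_cball _ sub]) auto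
      have "\<forall>\<^sub>F n in sequentially. \<forall>s\<in>F. \<bar>?q n s x - s \<bullet> D x\<bar> < e / 2"
        unfolding eventually_ball_finite_distrib[OF F(2)]
      proof
        fix s assume "s \<in> F"
        with elim F have "(\<lambda>n. ?q n s x) \<longlonglongrightarrow> s \<bullet> D x" by auto
        from tendstoD[OF this, of "e/2"] that show "\<forall>\<^sub>F n in sequentially. \<bar>?q n s x - s \<bullet> D x\<bar> < e / 2"
          by (simp add: dist_real_def)
      qed
      then obtain N where N: "\<And>n s. n \<ge> N \<Longrightarrow> s \<in> F \<Longrightarrow> \<bar>?q n s x - s \<bullet> D x\<bar> < e / 2"
        by (auto simp: eventually_sequentially)
      have "\<bar>?q n v x - v \<bullet> D x\<bar> \<le> e" if nN: "n \<ge> N" and v: "norm v \<le> 1" for n v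
      proof -
        obtain s where s: "s \<in> F" "norm (v - s) < d"
          using subsetD[OF F(3), of v] v by (auto simp: dist_norm norm_minus_commute)
        have "\<bar>?q n v x - v \<bullet> D x\<bar> \<le> \<bar>?q n v x - ?q n s x\<bar> + \<bar>?q n s x - s \<bullet> D x\<bar> + \<bar>(s - v) \<bullet> D x\<bar>"
          by (simp add: inner_diff_left)
        also have "\<dots> \<le> L * norm (v - s) + e / 2 + norm (v - s) * norm (D x)"
          using dyadic_quotient_lipschitz[OF lip, of n v x s] N[OF nN s(1)]
            Cauchy_Schwarz_ineq2[of "s - v" "D x"] by (simp add: norm_minus_commute)
        also have "\<dots> \<le> (L + norm (D x) + 1) * d + e / 2"
          using s(2) L0 norm_ge_zero[of "D x"] d0
            mult_left_mono[of "norm (v - s)" d "L + norm (D x)"] by (simp add: algebra_simps)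
        also have "(L + norm (D x) + 1) * d = e / 2"
          unfolding d_def using pos
          by (subst times_divide_eq_right, intro nonzero_mult_div_cancel_left) linarith
        finally show ?thesis by simp
      qed
      then show ?thesis by blast
    qed
    have "(f has_derivative (\<lambda>h. h \<bullet> D x)) (at x)"
      unfolding has_derivative_at_alt
    proof (intro conjI allI impI)
      show "bounded_linear (\<lambda>h. h \<bullet> D x)" by (rule bounded_linear_inner_left)
      fix e :: real assume "e > 0"
      then obtain N where N: "\<And>n v. n \<ge> N \<Longrightarrow> norm v \<le> 1 \<Longrightarrow> \<bar>?q n v x - v \<bullet> D x\<bar> \<le> e / 2"
        using unif[OF half_gt_zero[OF \<open>e > 0\<close>]] by blast
      show "\<exists>d>0. \<forall>y. norm (y - x) < d \<longrightarrow> norm (f y - f x - (y - x) \<bullet> D x) \<le> e * norm (y - x)"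
      proof (intro exI[of _ "(1/2)^N"] conjI allI impI)
        fix y assume y: "norm (y - x) < (1/2) ^ N"
        show "norm (f y - f x - (y - x) \<bullet> D x) \<le> e * norm (y - x)"
        proof (cases "y = x")
          case False
          then have r: "norm (y - x) > 0" by simp
          \<comment> \<open>With \<open>n = m - 1\<close> the increment \<open>y - x\<close> is
            \<open>(1/2) ^ n\<close> times a vector of norm between 1/2 and 1. The lower bound 1/2
            is why the uniform estimate is invoked with \<open>e / 2\<close>.\<close>
          define m where "m = (LEAST m. (1/2) ^ m < norm (y - x))"
          have ex: "\<exists>m. (1/2) ^ m < norm (y - x)" using r by (simp add: real_arch_pow_inv)
          then have m: "(1/2) ^ m < norm (y - x)" unfolding m_def by (rule LeastI_ex)
          have "(1/2 :: real) ^ m < (1/2) ^ N" using m y by linarith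
          then have "N < m" by (simp add: power_strict_decreasing_iff)
          then obtain n where n: "m = Suc n" "N \<le> n" by (cases m) auto
          have "\<not> (1/2) ^ n < norm (y - x)" using not_less_Least[of n] n(1) unfolding m_def by (metis lessI)
          then have n2: "norm (y - x) \<le> (1/2) ^ n" by simp
          define v where "v = 2 ^ n *\<^sub>R (y - x)"
          have nv: "norm v = 2 ^ n * norm (y - x)" unfolding v_def norm_scaleR by simp
          have xv: "x + (1/2) ^ n *\<^sub>R v = y" by (simp add: v_def power_divide)
          have "norm v \<le> 1" using n2 unfolding nv by (simp add: power_divide field_simps)
          from N[OF n(2) this] have "\<bar>?q n v x - v \<bullet> D x\<bar> \<le> e / 2" .
          moreover have "?q n v x - v \<bullet> D x = (f y - f x - (y - x) \<bullet> D x) * 2 ^ n"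
            unfolding dyadic_quotient_def xv by (simp add: v_def left_diff_distrib)
          ultimately have "\<bar>f y - f x - (y - x) \<bullet> D x\<bar> * 2 ^ n \<le> e / 2"
            by (simp add: abs_mult)
          then have "\<bar>f y - f x - (y - x) \<bullet> D x\<bar> \<le> e * ((1/2) ^ m)"
            by (simp add: n(1) field_simps power_divide)
          also have "\<dots> \<le> e * norm (y - x)" using m \<open>e > 0\<close> by simp
          finally show ?thesis by simp
        qed simp
      qed simp
    qed
    then show ?case unfolding gderiv_def by blast
  qed
  moreover have "D \<in> borel_measurable borel" unfolding D_def by measurable
  ultimately show ?thesis using that by blast
qed

section \<open>Gradient bounds along segments\<close>

text \<open>McShane's extension, an infimum of cones of slope \<open>L\<close>. It lets the global
  form of Rademacher's theorem be applied to functions that are only locally Lipschitz.\<close>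

lemma lipschitz_extension:
  fixes f :: "'a::metric_space \<Rightarrow> real"
  assumes lip: "L-lipschitz_on S f"
  obtains F where "L-lipschitz_on UNIV F" "\<And>x. x \<in> S \<Longrightarrow> F x = f x"
proof (cases "S = {}")
  case True
  have "L-lipschitz_on UNIV (\<lambda>x::'a. 0 :: real)"
    by (rule lipschitz_onI) (use lipschitz_on_nonneg[OF lip] in auto)
  with True that show ?thesis by auto
next
  case False
  then obtain s where s: "s \<in> S" by blast
  have L0: "0 \<le> L" using lip by (rule lipschitz_on_nonneg)
  have fl: "f x \<le> f y + L * dist x y" if "x \<in> S" "y \<in> S" for x y
    using lipschitz_onD[OF lip that] by (simp add: dist_real_def)
  define F where "F x = (INF y\<in>S. f y + L * dist x y)" for x
  have tri: "L * dist s x \<le> L * dist s z + L * dist z x" for s z x :: 'a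
    using mult_left_mono[OF dist_triangle L0] by (simp add: algebra_simps)
  have bdd: "bdd_below ((\<lambda>y. f y + L * dist x y) ` S)" for x
  proof (rule bdd_belowI2)
    fix y assume "y \<in> S"
    then show "f s - L * dist s x \<le> f y + L * dist x y"
      using fl[OF s, of y] tri[of s y x] by (simp add: dist_commute)
  qed
  have le: "F x \<le> F z + L * dist x z" for x z
  proof -
    have "F x - L * dist x z \<le> f y + L * dist z y" if "y \<in> S" for y
      using cINF_lower[OF bdd that, of x] tri[of x y z] unfolding F_def by simp
    then have "F x - L * dist x z \<le> F z" unfolding F_def[of z] by (intro cINF_greatest[OF False])
    then show ?thesis by simp
  qed
  have "F x = f x" if "x \<in> S" for x
  proof (rule antisym)
    show "F x \<le> f x" using cINF_lower[OF bdd that, of x] by (simp add: F_def)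
    show "f x \<le> F x" unfolding F_def by (rule cINF_greatest[OF False]) (use fl that in auto)
  qed
  moreover have "L-lipschitz_on UNIV F"
  proof (rule lipschitz_onI)
    show "dist (F x) (F y) \<le> L * dist x y" for x y
      using le[of x y] le[of y x] by (simp add: dist_real_def abs_le_iff dist_commute)
  qed (rule L0)
  ultimately show ?thesis using that by blast
qed

lemma GDERIV_transform_within_open:
  assumes "GDERIV f x :> D" "open S" "x \<in> S" "\<And>y. y \<in> S \<Longrightarrow> f y = g y"
  shows "GDERIV g x :> D"
  using has_derivative_transform_within_open[OF assms(1)[unfolded gderiv_def] assms(2-4)]
  by (simp add: gderiv_def)

lemma Lip_loc_AE_GDERIV:
  fixes f :: "real ^ 'n \<Rightarrow> real"
  assumes V: "open V" and f: "f \<in> Lip_loc V"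
  shows "negligible {x \<in> V. \<not> (\<exists>D. GDERIV f x :> D)}" (is "negligible ?N")
proof (rule iffD2[OF locally_negligible_alt], rule ballI)
  fix x assume x: "x \<in> ?N"
  then obtain r where r: "r > 0" "cball x r \<subseteq> V"
    using V open_contains_cball by blast
  have "ball x r \<lless> V" using r by (simp add: compactly_contained_def)
  then obtain L where "L-lipschitz_on (ball x r) f" using f by (auto simp: Lip_loc_def)
  then obtain F where F: "L-lipschitz_on UNIV F" "\<And>y. y \<in> ball x r \<Longrightarrow> F y = f y"
    using lipschitz_extension by metis
  obtain G where G: "AE y in lborel. GDERIV F y :> G y"
    using Rademacher[OF F(1)] by blast
  have "?N \<inter> ball x r \<subseteq> {y. \<not> (GDERIV F y :> G y)}"
  proof
    fix y assume y: "y \<in> ?N \<inter> ball x r"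
    have "GDERIV f y :> G y" if "GDERIV F y :> G y"
      by (rule GDERIV_transform_within_open[OF that open_ball]) (use y F(2) in auto)
    with y show "y \<in> {y. \<not> (GDERIV F y :> G y)}" by blast
  qed
  moreover have "negligible {y. \<not> (GDERIV F y :> G y)}"
    using G by (simp add: AE_lborel_negligible_iff)
  ultimately have "negligible (?N \<inter> ball x r)" using negligible_subset by blast
  moreover have "openin (top_of_set ?N) (?N \<inter> ball x r)" by (simp add: openin_open_Int)
  ultimately show "\<exists>U. openin (top_of_set ?N) U \<and> x \<in> U \<and> negligible U"
    using x r(1) by (intro exI[of _ "?N \<inter> ball x r"]) simp
qed

lemma has_integral_le_AE_const:
  fixes h :: "real \<Rightarrow> real"
  assumes "(h has_integral I) {0..1}" "AE t in lborel. t \<in> {0..1} \<longrightarrow> h t \<le> c"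
  shows "I \<le> c"
proof -
  have "((\<lambda>t. min (h t) c) has_integral I) {0..1}"
    using assms(1) by (subst has_integral_AE[where g = h]) (use assms(2) in \<open>auto elim!: eventually_mono\<close>)
  from has_integral_le[OF this has_integral_const_real[of c 0 1]] show ?thesis by simp
qed

text \<open>A single segment may be a null set, on which an essential supremum says nothing. The
  bound is therefore integrated along almost every parallel translate of the segment and carried
  over by continuity.\<close>

lemma Linf_H_grad_le_imp_segment:
  fixes f :: "real ^ 'n \<Rightarrow> real"
  assumes V: "open V" and f: "f \<in> Lip_loc V" and "0 \<le> l"
    and le: "Linf_H_grad H V f \<le> ennreal l"
    and seg: "closed_segment x y \<subseteq> V"
    and c: "\<And>p. H p \<le> l \<Longrightarrow> p \<bullet> (y - x) \<le> c"
  shows "f y - f x \<le> c"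
proof -
  define v where "v = y - x"
  define good where "good z \<longleftrightarrow> (\<exists>D. GDERIV f z :> D \<and> H D \<le> l)" for z
  have "AE z in lebesgue_on V. ennreal (H (grad f z)) \<le> ennreal l"
    using esssup_AE[of "\<lambda>z. ennreal (H (grad f z))" "lebesgue_on V"] le
    unfolding Linf_H_grad_def by (auto elim!: eventually_mono intro: order_trans)
  then have "AE z in lebesgue. z \<in> V \<longrightarrow> ennreal (H (grad f z)) \<le> ennreal l"
    using V by (subst (asm) AE_restrict_space_iff) auto
  then have "AE z in lborel. z \<in> V \<longrightarrow> ennreal (H (grad f z)) \<le> ennreal l"
    by (simp add: AE_completion_iff)
  moreover have "AE z in lborel. z \<in> V \<longrightarrow> (\<exists>D. GDERIV f z :> D)"
    unfolding AE_lborel_negligible_iff using Lip_loc_AE_GDERIV[OF V f] by simp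
  ultimately have "AE z in lborel. z \<in> V \<longrightarrow> good z"
  proof eventually_elim
    case (elim z)
    show ?case
    proof
      assume "z \<in> V"
      with elim obtain D where D: "GDERIV f z :> D" "ennreal (H (grad f z)) \<le> ennreal l" by blast
      then have "H D \<le> l" using \<open>0 \<le> l\<close> by (simp add: grad_eqI)
      with D(1) show "good z" by (auto simp: good_def)
    qed
  qed
  \<comment> \<open>A Borel null set containing all bad points is needed, since the set of bad
    points itself is not known to be Borel.\<close>
  then obtain N where N: "{z. \<not> (z \<in> V \<longrightarrow> good z)} \<subseteq> N" "N \<in> null_sets lborel"
    by (auto elim!: AE_E simp: null_sets_def)
  then have [measurable]: "N \<in> sets borel" by auto
  have "AE z in lborel. z \<notin> N" using N(2) by (rule AE_not_in)
  then have line: "AE z in lborel. AE t in (lborel :: real measure). t *\<^sub>R v + z \<notin> N"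
    using AE_lborel_line_iff[of "\<lambda>z. z \<notin> N" v] by simp
  let ?S = "closed_segment x y"
  obtain e where e: "e > 0" "{z. infdist z ?S \<le> e} \<subseteq> V"
    using compact_in_open_separated[OF _ compact_segment V seg] by auto
  \<comment> \<open>A tube around the segment: it contains all translates by less than
    \<open>e\<close>, and \<open>f\<close> is Lipschitz on it.\<close>
  define W where "W = {z. infdist z ?S < e}"
  have "open W" unfolding W_def by (intro open_Collect_less continuous_intros)
  have clW: "closure W \<subseteq> {z. infdist z ?S \<le> e}"
    by (rule closure_minimal) (auto simp: W_def intro!: closed_Collect_le continuous_intros)
  have "compact {z. infdist z ?S \<le> e}" by (rule compact_infdist_le) (use e in auto)
  with clW have "compact (closure W)" by (metis closed_closure compact_Int_closed inf.absorb2)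
  with \<open>open W\<close> clW e(2) have "W \<lless> V" by (auto simp: compactly_contained_def)
  then obtain L where "L-lipschitz_on W f" using f by (auto simp: Lip_loc_def)
  then obtain F where F: "L-lipschitz_on UNIV F" "\<And>z. z \<in> W \<Longrightarrow> F z = f z"
    using lipschitz_extension by metis
  have WV: "W \<subseteq> V" using e(2) by (auto simp: W_def)
  have inW: "t *\<^sub>R v + z \<in> W" if "t \<in> {0..1}" "z \<in> ball x e" for t z
  proof -
    have "x + t *\<^sub>R v \<in> ?S" using that(1)
      by (auto simp: closed_segment_def v_def algebra_simps intro!: exI[of _ t])
    then have "infdist (t *\<^sub>R v + z) ?S \<le> dist (t *\<^sub>R v + z) (x + t *\<^sub>R v)" by (rule infdist_le)
    also have "\<dots> < e" using that(2) by (simp add: dist_norm algebra_simps norm_minus_commute)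
    finally show ?thesis by (simp add: W_def)
  qed
  have "AE z in lborel. z \<in> ball x e \<longrightarrow> F (z + v) - F z \<le> c"
    using line
  proof eventually_elim
    case (elim z)
    show ?case
    proof
      assume z: "z \<in> ball x e"
      define g where "g t = F (t *\<^sub>R v + z)" for t
      have "(L * norm v)-lipschitz_on UNIV g"
      proof (rule lipschitz_onI)
        fix s t :: real
        have "dist (g s) (g t) \<le> L * dist (s *\<^sub>R v + z) (t *\<^sub>R v + z)"
          unfolding g_def by (rule lipschitz_onD[OF F(1)]) auto
        also have "dist (s *\<^sub>R v + z) (t *\<^sub>R v + z) = norm v * dist s t"
          by (simp add: dist_norm scaleR_diff_left[symmetric])
        finally show "dist (g s) (g t) \<le> L * norm v * dist s t" by (simp add: mult.assoc)
      qed (use lipschitz_on_nonneg[OF F(1)] in simp)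
      then obtain h M where M: "negligible M"
        "\<And>a b. a \<le> b \<Longrightarrow> (h has_integral (g b - g a)) {a..b}"
        "\<And>t. t \<notin> M \<Longrightarrow> (g has_real_derivative h t) (at t)"
        using lipschitz_real_AE_derivative by metis
      have "AE t in lborel. t \<notin> M"
        using M(1) by (simp add: AE_lborel_negligible_iff)
      with elim have "AE t in lborel. t \<in> {0..1} \<longrightarrow> h t \<le> c"
      proof eventually_elim
        case (elim t)
        show ?case
        proof
          assume t: "t \<in> {0..1}"
          note w = inW[OF t z]
          from elim(1) N(1) w WV have "good (t *\<^sub>R v + z)" by blast
          then obtain D where D: "GDERIV f (t *\<^sub>R v + z) :> D" "H D \<le> l" by (auto simp: good_def)
          have "GDERIV F (t *\<^sub>R v + z) :> D"
            by (rule GDERIV_transform_within_open[OF D(1) \<open>open W\<close> w]) (use F(2) in simp)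
          then have "(F has_derivative (\<lambda>h. h \<bullet> D)) (at (t *\<^sub>R v + z))" by (simp add: gderiv_def)
          moreover have "((\<lambda>t. t *\<^sub>R v + z) has_derivative (\<lambda>s. s *\<^sub>R v)) (at t)"
            by (auto intro!: derivative_eq_intros)
          ultimately have "(g has_derivative (\<lambda>s. (s *\<^sub>R v) \<bullet> D)) (at t)"
            unfolding g_def using has_derivative_compose by blast
          moreover have "(\<lambda>s. (s *\<^sub>R v) \<bullet> D) = (*) (v \<bullet> D)" by (auto simp: fun_eq_iff)
          ultimately have "(g has_real_derivative (v \<bullet> D)) (at t)"
            by (simp only: has_field_derivative_def)
          with M(3)[OF elim(2)] have "h t = v \<bullet> D" by (rule DERIV_unique)
          with c[OF D(2)] show "h t \<le> c" by (simp add: v_def inner_commute)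
        qed
      qed
      from has_integral_le_AE_const[OF M(2) this] show "F (z + v) - F z \<le> c"
        by (simp add: g_def add.commute)
    qed
  qed
  \<comment> \<open>The exceptional starting points form a set that is both open and null, hence
    empty; in particular \<open>x\<close> is not one of them.\<close>
  then have neg: "negligible {z \<in> ball x e. \<not> F (z + v) - F z \<le> c}"
    by (simp add: AE_lborel_negligible_iff)
  have Fc: "continuous_on UNIV F" by (rule lipschitz_on_continuous_on[OF F(1)])
  have "open {z. c < F (z + v) - F z}"
    by (intro open_Collect_less continuous_intros continuous_on_compose2[OF Fc]) auto
  then have "open (ball x e \<inter> {z. c < F (z + v) - F z})" by (intro open_Int open_ball)
  moreover have "ball x e \<inter> {z. c < F (z + v) - F z} = {z \<in> ball x e. \<not> F (z + v) - F z \<le> c}" by auto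
  ultimately have emp: "ball x e \<inter> {z. c < F (z + v) - F z} = {}"
    using neg open_not_negligible by metis
  have "F (x + v) - F x \<le> c"
  proof (rule ccontr)
    assume "\<not> F (x + v) - F x \<le> c"
    then have "x \<in> ball x e \<inter> {z. c < F (z + v) - F z}" using e(1) by simp
    with emp show False by blast
  qed
  moreover have "F (x + v) = f y" "F x = f x"
    using inW[of 1 x] inW[of 0 x] e(1) F(2) by (auto simp: v_def)
  ultimately show ?thesis by simp
qed

lemma Linf_H_grad_leI:
  fixes f :: "real ^ 'n \<Rightarrow> real"
  assumes V: "open V" and lip: "L-lipschitz_on UNIV f" and H: "continuous_on UNIV H"
    and le: "\<And>x D. GDERIV f x :> D \<Longrightarrow> H D \<le> l"
  shows "Linf_H_grad H V f \<le> ennreal l"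
proof -
  obtain G where G: "G \<in> borel_measurable borel" "AE x in lborel. GDERIV f x :> G x"
    using Rademacher[OF lip] by blast
  have [measurable]: "H \<in> borel_measurable borel" by (rule borel_measurable_continuous_onI[OF H])
  let ?h = "\<lambda>x. ennreal (H (grad f x))" and ?k = "\<lambda>x. ennreal (H (G x))"
  have AE: "AE x in lebesgue. GDERIV f x :> G x" using G(2) by (simp add: AE_completion_iff)
  have k: "?k \<in> borel_measurable lebesgue"
    by (rule measurable_completion) (use G(1) in simp)
  \<comment> \<open>\<open>esssup_I\<close> requires measurability, which is not evident for
    \<open>grad f\<close>. It is inherited from the Borel version \<open>G\<close>, equal almost
    everywhere, through completeness of Lebesgue measure.\<close>
  have "?h \<in> borel_measurable lebesgue"
  proof (rule measurableI)
    fix A :: "ennreal set" assume "A \<in> sets borel"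
    then have "?k -` A \<inter> space lebesgue \<in> sets lebesgue" by (rule measurable_sets[OF k])
    moreover have "AE x in lebesgue. x \<in> ?k -` A \<inter> space lebesgue \<longleftrightarrow> x \<in> ?h -` A \<inter> space lebesgue"
      using AE by eventually_elim (simp add: grad_eqI)
    ultimately show "?h -` A \<inter> space lebesgue \<in> sets lebesgue"
      using completion.in_sets_AE by blast
  qed simp
  then have "?h \<in> borel_measurable (lebesgue_on V)" by (rule measurable_restrict_space1)
  moreover have "AE x in lebesgue_on V. ?h x \<le> ennreal l"
    using AE V by (subst AE_restrict_space_iff)
      (auto elim!: eventually_mono simp: grad_eqI intro!: ennreal_leI le)
  ultimately show ?thesis unfolding Linf_H_grad_def by (rule esssup_I)
qed

text \<open>Stated through segments rather than gradients, so that replacing \<open>u\<close> by \<open>- u\<close> and \<open>H\<close> by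
  its reflection involves no points of non-differentiability.\<close>

definition segment_comparison :: "(real ^ 'n \<Rightarrow> real) \<Rightarrow> (real ^ 'n) set \<Rightarrow> (real ^ 'n \<Rightarrow> real) \<Rightarrow> bool"
  where "segment_comparison H U u \<longleftrightarrow> (\<forall>V w L l x y c. V \<lless> U \<longrightarrow> L-lipschitz_on UNIV w \<longrightarrow> 0 \<le> l \<longrightarrow>
    (\<forall>z D. GDERIV w z :> D \<longrightarrow> H D \<le> l) \<longrightarrow> (\<forall>z\<in>frontier V. w z = u z) \<longrightarrow> (\<forall>z\<in>V. w z \<le> u z) \<longrightarrow>
    closed_segment x y \<subseteq> V \<longrightarrow> (\<forall>p. H p \<le> l \<longrightarrow> p \<bullet> (y - x) \<le> c) \<longrightarrow> u y - u x \<le> c)"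

lemma lipschitz_on_UNIV_Lip_loc: "L-lipschitz_on UNIV w \<Longrightarrow> w \<in> Lip_loc V"
  unfolding Lip_loc_def by (blast intro: lipschitz_on_subset)

lemma Lip_loc_subset: "f \<in> Lip_loc U \<Longrightarrow> V \<subseteq> U \<Longrightarrow> f \<in> Lip_loc V"
  unfolding Lip_loc_def compactly_contained_def by blast

lemma absolutely_subminimizing_segment_comparison:
  fixes H :: "real ^ 'n \<Rightarrow> real"
  assumes H: "continuous_on UNIV H" and u: "absolutely_subminimizing H U u"
  shows "segment_comparison H U u"
  unfolding segment_comparison_def
proof (intro allI impI)
  fix V w L l x y c
  assume V: "V \<lless> U" and w: "L-lipschitz_on UNIV w" and l: "0 \<le> l"
    and D: "\<forall>z D. GDERIV w z :> D \<longrightarrow> H D \<le> l"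
    and fr: "\<forall>z\<in>frontier V. w z = u z" and le: "\<forall>z\<in>V. w z \<le> u z"
    and s: "closed_segment x y \<subseteq> V" and c: "\<forall>p. H p \<le> l \<longrightarrow> p \<bullet> (y - x) \<le> c"
  have V': "open V" "V \<subseteq> U" using V closure_subset by (auto simp: compactly_contained_def)
  have "Linf_H_grad H V u \<le> Linf_H_grad H V w"
    using u V fr le lipschitz_on_UNIV_Lip_loc[OF w] lipschitz_on_continuous_on[OF w]
    unfolding absolutely_subminimizing_def by (blast intro: continuous_on_subset)
  also have "\<dots> \<le> ennreal l" using Linf_H_grad_leI[OF V'(1) w H, of l] D by blast
  finally show "u y - u x \<le> c"
    using Linf_H_grad_le_imp_segment[OF V'(1) _ l _ s] c Lip_loc_subset[OF _ V'(2)] u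
    unfolding absolutely_subminimizing_def by blast
qed

text \<open>A competitor \<open>w\<close> below \<open>- u\<close> gives the competitor
  \<open>- w\<close> above \<open>u\<close>. The gradient bound is applied to \<open>u\<close>
  itself along the segment traversed backwards, which accounts for the reflection of
  \<open>H\<close>.\<close>

lemma absolutely_superminimizing_segment_comparison:
  fixes H :: "real ^ 'n \<Rightarrow> real"
  assumes H: "continuous_on UNIV H" and u: "absolutely_superminimizing H U u"
  shows "segment_comparison (\<lambda>p. H (- p)) U (\<lambda>x. - u x)"
  unfolding segment_comparison_def
proof (intro allI impI)
  fix V w L l x y c
  assume V: "V \<lless> U" and w: "L-lipschitz_on UNIV w" and l: "0 \<le> l"
    and D: "\<forall>z D. GDERIV w z :> D \<longrightarrow> H (- D) \<le> l"
    and fr: "\<forall>z\<in>frontier V. w z = - u z" and le: "\<forall>z\<in>V. w z \<le> - u z"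
    and s: "closed_segment x y \<subseteq> V" and c: "\<forall>p. H (- p) \<le> l \<longrightarrow> p \<bullet> (y - x) \<le> c"
  have V': "open V" "V \<subseteq> U" using V closure_subset by (auto simp: compactly_contained_def)
  define w' where "w' z = - w z" for z
  have w': "L-lipschitz_on UNIV w'" using w unfolding w'_def by (simp add: lipschitz_on_def dist_minus)
  have D': "H D \<le> l" if "GDERIV w' z :> D" for z D
  proof -
    have "GDERIV (\<lambda>z. - w' z) z :> - D" using that by (rule GDERIV_minus)
    then have "GDERIV w z :> - D" by (simp add: w'_def)
    then show ?thesis using D by fastforce
  qed
  have fr': "\<forall>z\<in>frontier V. w' z = u z" using fr by (simp add: w'_def)
  have le': "\<forall>z\<in>V. u z \<le> w' z" using le by (force simp: w'_def)
  have "Linf_H_grad H V u \<le> Linf_H_grad H V w'"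
    using u V fr' le' lipschitz_on_UNIV_Lip_loc[OF w'] lipschitz_on_continuous_on[OF w']
    unfolding absolutely_superminimizing_def by (blast intro: continuous_on_subset)
  also have "\<dots> \<le> ennreal l" using Linf_H_grad_leI[OF V'(1) w' H, of l] D' by blast
  finally have Lu: "Linf_H_grad H V u \<le> ennreal l" .
  have c': "p \<bullet> (x - y) \<le> c" if "H p \<le> l" for p
    using c[rule_format, of "- p"] that by (simp add: inner_diff_right)
  have "u x - u y \<le> c"
  proof (rule Linf_H_grad_le_imp_segment[OF V'(1) _ l Lu _ c'])
    show "u \<in> Lip_loc V" using Lip_loc_subset[OF _ V'(2)] u by (simp add: absolutely_superminimizing_def)
    show "closed_segment y x \<subseteq> V" using s by (simp add: closed_segment_commute)
  qed
  then show "- u y - - u x \<le> c" by simp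
qed

section \<open>The Hopf-Lax cost of a Hamiltonian\<close>

locale hamiltonian =
  fixes H :: "real ^ 'n \<Rightarrow> real"
  assumes conv: "convex_on UNIV H"
    and H0: "H 0 = 0"
    and nonneg: "H p \<ge> 0"
    and bdd0: "bounded {p. H p = 0}"
begin

lemma cont: "continuous_on UNIV H"
  using convex_on_continuous[OF open_UNIV conv] .

lemma cont': "continuous_on S H"
  using cont continuous_on_subset by blast

lemma convexD: "0 \<le> s \<Longrightarrow> s \<le> 1 \<Longrightarrow> H ((1 - s) *\<^sub>R p + s *\<^sub>R q) \<le> (1 - s) * H p + s * H q"
  using conv unfolding convex_on_def by (metis UNIV_I add.commute diff_add_cancel diff_ge_0_iff_ge)

text \<open>On a sphere enclosing the zero set \<open>H\<close> has a positive minimum; as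
  \<open>H 0 = 0\<close>, convexity makes \<open>H\<close> grow at least linearly along rays beyond
  it.\<close>

lemma bounded_sublevel: "bounded {p. H p \<le> l}"
proof -
  obtain R where R: "R > 0" "\<And>p. H p = 0 \<Longrightarrow> norm p < R"
    using bdd0 unfolding bounded_pos_less by blast
  have "\<exists>p \<in> sphere (0 :: real ^ 'n) R. \<forall>q \<in> sphere 0 R. H p \<le> H q"
    by (rule continuous_attains_inf[OF compact_sphere _ cont']) (use R(1) in simp)
  then obtain p0 where p0: "norm p0 = R" "\<And>q. norm q = R \<Longrightarrow> H p0 \<le> H q" by auto
  have m: "H p0 > 0" using R(2)[of p0] p0(1) nonneg[of p0] by fastforce
  have "norm p \<le> R + l * R / H p0" if p: "H p \<le> l" for p
  proof (cases "norm p \<le> R")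
    case True
    have "0 \<le> l" using nonneg[of p] p by linarith
    then have "0 \<le> l * R / H p0" using m R(1) by simp
    with True show ?thesis by linarith
  next
    case False
    define s where "s = R / norm p"
    have s: "0 < s" "s \<le> 1" using False R(1) by (auto simp: s_def divide_simps)
    have pz: "p \<noteq> 0" using False R(1) by auto
    then have "norm (s *\<^sub>R p) = R" using R(1) by (simp add: s_def)
    then have "H p0 \<le> H (s *\<^sub>R p)" by (rule p0(2))
    also have "\<dots> \<le> s * H p" using convexD[of s 0 p] s by (simp add: H0)
    also have "\<dots> \<le> s * l" using p s by simp
    finally have "H p0 * norm p \<le> R * l" using pz R(1) by (simp add: s_def divide_simps)
    then have "norm p \<le> l * R / H p0" using m by (simp add: pos_le_divide_eq mult.commute)
    with R(1) show ?thesis by linarith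
  qed
  then show ?thesis unfolding bounded_iff by blast
qed

lemma convex_sublevel: "convex {p. H p \<le> l}"
  unfolding convex_alt
proof safe
  fix p q s assume *: "H p \<le> l" "H q \<le> l" "0 \<le> (s::real)" "s \<le> 1"
  have "H ((1 - s) *\<^sub>R p + s *\<^sub>R q) \<le> (1 - s) * H p + s * H q" using * by (intro convexD)
  also have "\<dots> \<le> (1 - s) * l + s * l" using * by (intro add_mono mult_left_mono) auto
  finally show "H ((1 - s) *\<^sub>R p + s *\<^sub>R q) \<le> l" by (simp add: algebra_simps)
qed

lemma compact_sublevel: "compact {p. H p \<le> l}"
proof -
  have "closed {p. H p \<le> l}" by (intro closed_Collect_le cont continuous_intros)
  with bounded_sublevel show ?thesis by (simp add: compact_eq_bounded_closed)
qed

text \<open>For \<open>t > 0\<close> this is \<open>t * L (z / t)\<close>, where \<open>L\<close> is the Legendre transform of \<open>H\<close> modified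
  to be infinite outside \<open>{H \<le> m}\<close>; for \<open>t = 0\<close> it is the support function of that set.\<close>

definition cost :: "real \<Rightarrow> real \<Rightarrow> real ^ 'n \<Rightarrow> real"
  where "cost m t z = (SUP p\<in>{p. H p \<le> m}. p \<bullet> z - t * H p)"

lemma cost_maximizer:
  assumes "0 \<le> m"
  obtains p where "H p \<le> m" "cost m t z = p \<bullet> z - t * H p"
    "\<And>q. H q \<le> m \<Longrightarrow> q \<bullet> z - t * H q \<le> cost m t z"
proof -
  have "\<exists>p\<in>{p. H p \<le> m}. \<forall>q\<in>{p. H p \<le> m}. q \<bullet> z - t * H q \<le> p \<bullet> z - t * H p"
  proof (rule continuous_attains_sup[OF compact_sublevel])
    have "0 \<in> {p. H p \<le> m}" using assms H0 by simp
    then show "{p. H p \<le> m} \<noteq> {}" by blast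
    show "continuous_on {p. H p \<le> m} (\<lambda>p. p \<bullet> z - t * H p)"
      by (intro continuous_intros cont')
  qed
  then obtain p where p: "H p \<le> m" "\<And>q. H q \<le> m \<Longrightarrow> q \<bullet> z - t * H q \<le> p \<bullet> z - t * H p" by blast
  have "cost m t z = p \<bullet> z - t * H p"
    unfolding cost_def by (rule cSup_eq_maximum) (use p in auto)
  with p that show ?thesis by metis
qed

lemma cost_ge: "H p \<le> m \<Longrightarrow> p \<bullet> z - t * H p \<le> cost m t z"
  using cost_maximizer[of m t z] nonneg[of p] by (metis order_trans)

lemma cost_le:
  assumes "0 \<le> m" "\<And>p. H p \<le> m \<Longrightarrow> p \<bullet> z - t * H p \<le> c"
  shows "cost m t z \<le> c"
  using cost_maximizer[OF assms(1), of t z] assms(2) by metis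

lemma cost_nonneg: "0 \<le> m \<Longrightarrow> 0 \<le> cost m t z"
  using cost_ge[of 0 m z t] H0 by simp

lemma cost_zero: "0 \<le> m \<Longrightarrow> 0 \<le> t \<Longrightarrow> cost m t 0 = 0"
  by (rule antisym[OF cost_le cost_nonneg]) (use nonneg in auto)

lemma cost_add_le: "0 \<le> m \<Longrightarrow> cost m t (z + h) \<le> cost m t z + cost m 0 h"
proof (rule cost_le)
  fix p assume "H p \<le> m"
  from cost_ge[OF this, of z t] cost_ge[OF this, of h 0]
  show "p \<bullet> (z + h) - t * H p \<le> cost m t z + cost m 0 h" by (simp add: inner_add_right)
qed

lemma cost_scale:
  assumes "0 \<le> m" "0 < s"
  shows "cost m (s * t) (s *\<^sub>R z) = s * cost m t z"
proof (rule antisym)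
  show "cost m (s * t) (s *\<^sub>R z) \<le> s * cost m t z"
    by (rule cost_le[OF assms(1)])
      (use cost_ge[of _ m z t] assms(2) in \<open>simp add: right_diff_distrib[symmetric] mult.assoc\<close>)
  obtain p where p: "H p \<le> m" "cost m t z = p \<bullet> z - t * H p"
    using cost_maximizer[OF assms(1)] by metis
  show "s * cost m t z \<le> cost m (s * t) (s *\<^sub>R z)"
    using cost_ge[OF p(1), of "s *\<^sub>R z" "s * t"] by (simp add: p(2) right_diff_distrib mult.assoc)
qed

lemma cost_lipschitz:
  assumes "0 \<le> m"
  obtains R where "0 < R" "\<And>p. H p \<le> m \<Longrightarrow> norm p \<le> R"
    "\<And>t. R-lipschitz_on UNIV (cost m t)"
proof -
  obtain R where R: "0 < R" "\<And>p. H p \<le> m \<Longrightarrow> norm p \<le> R"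
    using bounded_sublevel[of m] unfolding bounded_pos by blast
  have h: "cost m 0 h \<le> R * norm h" for h
  proof (rule cost_le[OF assms])
    fix p assume "H p \<le> m"
    then show "p \<bullet> h - 0 * H p \<le> R * norm h"
      using norm_cauchy_schwarz[of p h] mult_right_mono[OF R(2) norm_ge_zero, of p h] by simp
  qed
  have le: "cost m t y \<le> cost m t z + R * norm (y - z)" for t y z
    using cost_add_le[OF assms, of t z "y - z"] h[of "y - z"] by simp
  have "R-lipschitz_on UNIV (cost m t)" for t
  proof (rule lipschitz_onI)
    show "dist (cost m t y) (cost m t z) \<le> R * dist y z" for y z
      using le[of t y z] le[of t z y] by (simp add: dist_real_def abs_le_iff dist_norm norm_minus_commute)
  qed (use R in simp)
  with R that show ?thesis by blast
qed

lemma cost_continuous: "0 \<le> m \<Longrightarrow> continuous_on S (cost m t)"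
  using cost_lipschitz lipschitz_on_continuous_on continuous_on_subset by (metis subset_UNIV)

text \<open>Coercivity, by testing with the multiple of \<open>z\<close> of norm \<open>K\<close>.
  This is what lets the cost dominate the increments of a \<open>K\<close>-Lipschitz function up to
  an error \<open>t * l\<close>.\<close>

lemma cost_lower:
  assumes "\<And>p. norm p \<le> K \<Longrightarrow> H p \<le> l" "l \<le> m" "0 \<le> K" "0 \<le> t"
  shows "K * norm z - t * l \<le> cost m t z"
proof (cases "z = 0")
  case True
  have "0 \<le> l" using assms(1)[of 0] assms(3) H0 by simp
  then have "0 \<le> t * l" using assms(4) by simp
  then show ?thesis using True cost_nonneg[of m t z] \<open>0 \<le> l\<close> assms(2) by simp
next
  case False
  define p where "p = (K / norm z) *\<^sub>R z"
  have "norm p = K" using False assms(3) by (simp add: p_def)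
  then have "H p \<le> l" using assms(1) by simp
  have "p \<bullet> z = K * norm z" using False by (simp add: p_def dot_square_norm power2_eq_square)
  moreover have "t * H p \<le> t * l" using \<open>H p \<le> l\<close> assms(4) by (rule mult_left_mono)
  ultimately show ?thesis using cost_ge[of p m z t] \<open>H p \<le> l\<close> assms(2) by simp
qed

text \<open>Subadditivity bounds each directional derivative of the cone by the support function of
  the sublevel set. A gradient outside that closed convex set would violate this in a separating
  direction.\<close>

lemma GDERIV_support_function:
  assumes "0 \<le> l" and D: "GDERIV (\<lambda>y. a + cost l 0 (y - x)) y :> D"
  shows "H D \<le> l"
proof (rule ccontr)
  assume nD: "\<not> H D \<le> l"
  have cl: "closed {p. H p \<le> l}" using compact_sublevel compact_imp_closed by blast
  obtain h b where hb: "h \<bullet> D < b" "\<And>p. H p \<le> l \<Longrightarrow> b < h \<bullet> p"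
    using separating_hyperplane_closed_point[OF convex_sublevel cl, of D] nD by auto
  have le: "(- h) \<bullet> D \<le> cost l 0 (- h)"
  proof -
    let ?w = "\<lambda>y. a + cost l 0 (y - x)"
    have "(?w has_derivative (\<lambda>k. k \<bullet> D)) (at (y + 0 *\<^sub>R (- h)))" using D by (simp add: gderiv_def)
    moreover have "((\<lambda>s. y + s *\<^sub>R (- h)) has_derivative (\<lambda>s. s *\<^sub>R (- h))) (at 0)"
      by (auto intro!: derivative_eq_intros)
    ultimately have "((\<lambda>s. ?w (y + s *\<^sub>R (- h))) has_derivative (\<lambda>s. (s *\<^sub>R (- h)) \<bullet> D)) (at 0)"
      using has_derivative_compose by fastforce
    moreover have "(\<lambda>s. (s *\<^sub>R (- h)) \<bullet> D) = (*) ((- h) \<bullet> D)" by (auto simp: fun_eq_iff)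
    ultimately have "((\<lambda>s. ?w (y + s *\<^sub>R (- h))) has_real_derivative ((- h) \<bullet> D)) (at 0)"
      by (simp only: has_field_derivative_def)
    then have "((\<lambda>s. (?w (y + s *\<^sub>R (- h)) - ?w y) / s) \<longlongrightarrow> (- h) \<bullet> D) (at 0)"
      by (simp add: DERIV_def)
    then have "((\<lambda>s. (?w (y + s *\<^sub>R (- h)) - ?w y) / s) \<longlongrightarrow> (- h) \<bullet> D) (at_right 0)"
      by (rule filterlim_mono) (auto simp: at_le)
    moreover have "\<forall>\<^sub>F s in at_right 0. (?w (y + s *\<^sub>R (- h)) - ?w y) / s \<le> cost l 0 (- h)"
      using eventually_at_right_less
    proof eventually_elim
      case (elim s)
      have eq: "y + s *\<^sub>R (- h) - x = (y - x) + s *\<^sub>R (- h)" by simp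
      have "?w (y + s *\<^sub>R (- h)) - ?w y = cost l 0 ((y - x) + s *\<^sub>R (- h)) - cost l 0 (y - x)"
        by (simp only: eq add_diff_cancel_left)
      also have "\<dots> \<le> cost l 0 (s *\<^sub>R (- h))"
        using cost_add_le[OF assms(1), of 0 "y - x" "s *\<^sub>R (- h)"] by linarith
      also have "\<dots> = s * cost l 0 (- h)" using cost_scale[OF assms(1) elim, of 0 "- h"] by simp
      finally show ?case using elim by (simp add: pos_divide_le_eq mult.commute)
    qed
    ultimately show ?thesis by (rule tendsto_upperbound) simp
  qed
  obtain p where "H p \<le> l" "cost l 0 (- h) = p \<bullet> (- h) - 0 * H p"
    using cost_maximizer[OF assms(1)] by metis
  with le hb show False by (force simp: inner_commute)
qed

end

text \<open>The cost is an arbitrary function of two points, so that the lower operator arises from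
  the same definition by swapping the arguments of \<open>c\<close> and changing signs.\<close>

definition hopf_lax :: "'a set \<Rightarrow> ('a \<Rightarrow> 'a \<Rightarrow> real) \<Rightarrow> ('a \<Rightarrow> real) \<Rightarrow> 'a \<Rightarrow> real"
  where "hopf_lax X c w x = (SUP y\<in>X. w y - c x y)"

context hamiltonian
begin

text \<open>Limits of maximizers at points of the set approaching \<open>z\<close> satisfy \<open>H \<le> l\<close>, limits of maximizers
  at \<open>z\<close> for times increasing to \<open>s\<close> satisfy \<open>H \<ge> l\<close>; both maximize at \<open>z\<close> and \<open>s\<close>, so some point
  of the segment between them is a maximizer with \<open>H = l\<close>.\<close>

lemma cost_le_support_on_boundary:
  assumes m: "0 \<le> m" and l: "l \<le> m"
    and z: "z \<in> closure {z. \<exists>\<tau>\<in>{0..<s}. cost m \<tau> z + l * \<tau> < cost m s z + l * s}"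
    and nz: "\<And>\<tau>. 0 \<le> \<tau> \<Longrightarrow> \<tau> < s \<Longrightarrow> cost m s z + l * s \<le> cost m \<tau> z + l * \<tau>"
    and s: "0 < s"
  shows "cost m s z + l * s \<le> cost l 0 z"
proof -
  let ?K = "{p. H p \<le> m}"
  have seq: "\<exists>p\<in>?K. \<exists>r. strict_mono r \<and> ((f :: nat \<Rightarrow> real ^ 'n) \<circ> r) \<longlonglongrightarrow> p" if "\<And>n. f n \<in> ?K" for f
    using compact_sublevel[of m] that unfolding compact_def by blast
  obtain Z where Z: "\<And>n::nat. \<exists>\<tau>\<in>{0..<s}. cost m \<tau> (Z n) + l * \<tau> < cost m s (Z n) + l * s" "Z \<longlonglongrightarrow> z"
    using z unfolding closure_sequential by blast
  have "\<exists>p. H p \<le> m \<and> H p < l \<and> cost m s (Z n) = p \<bullet> Z n - s * H p" for n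
  proof -
    obtain p where p: "H p \<le> m" "cost m s (Z n) = p \<bullet> Z n - s * H p"
      using cost_maximizer[OF m] by metis
    obtain \<tau> where t: "0 \<le> \<tau>" "\<tau> < s" "cost m \<tau> (Z n) + l * \<tau> < cost m s (Z n) + l * s"
      using Z(1)[of n] by auto
    \<comment> \<open>The maximizer \<open>p\<close> for time \<open>s\<close> also competes at time
      \<open>\<tau>\<close>, where its value is larger by \<open>(s - \<tau>) * H p\<close>.\<close>
    have "(s - \<tau>) * (H p - l) < 0" using t(3) p(2) cost_ge[OF p(1), of "Z n" \<tau>] by (simp add: algebra_simps)
    with t(2) have "H p < l" by (simp add: mult_less_0_iff)
    with p show ?thesis by blast
  qed
  then obtain P where P: "\<And>n. H (P n) \<le> m" "\<And>n. H (P n) < l" "\<And>n. cost m s (Z n) = P n \<bullet> Z n - s * H (P n)"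
    by metis
  obtain p r where r: "strict_mono r" and p: "(P \<circ> r) \<longlonglongrightarrow> p" "H p \<le> m" using seq[of P] P(1) by blast
  have Hlim: "(\<lambda>n. H (f n)) \<longlonglongrightarrow> H q" if "f \<longlonglongrightarrow> q" for f q
    using continuous_on_tendsto_compose[OF cont that] by simp
  have Zr: "(Z \<circ> r) \<longlonglongrightarrow> z" using Z(2) r by (rule LIMSEQ_subseq_LIMSEQ)
  have Hp: "H p \<le> l"
    by (rule LIMSEQ_le_const2[OF Hlim[OF p(1)]]) (use P(2) in \<open>auto intro!: less_imp_le\<close>)
  have clim: "(\<lambda>n. cost m s (f n)) \<longlonglongrightarrow> cost m s q" if "f \<longlonglongrightarrow> q" for f q
    using continuous_on_tendsto_compose[OF cost_continuous[OF m, of UNIV] that] by simp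
  have "(\<lambda>n. (P \<circ> r) n \<bullet> (Z \<circ> r) n - s * H ((P \<circ> r) n)) \<longlonglongrightarrow> p \<bullet> z - s * H p"
    by (intro tendsto_intros p Zr Hlim)
  then have "(\<lambda>n. cost m s ((Z \<circ> r) n)) \<longlonglongrightarrow> p \<bullet> z - s * H p" by (simp add: P(3))
  with clim[OF Zr] have pmax: "cost m s z = p \<bullet> z - s * H p" by (rule LIMSEQ_unique)
  define \<tau> where "\<tau> n = s - s / real (Suc n)" for n
  have tau: "0 \<le> \<tau> n" "\<tau> n < s" for n using s by (auto simp: \<tau>_def divide_simps)
  have taulim: "\<tau> \<longlonglongrightarrow> s"
    unfolding \<tau>_def using tendsto_diff[OF tendsto_const[of s] LIMSEQ_Suc[OF lim_const_over_n[of s]]] by simp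
  have "\<exists>q. H q \<le> m \<and> cost m (\<tau> n) z = q \<bullet> z - \<tau> n * H q" for n
    using cost_maximizer[OF m] by metis
  then obtain Q where Q: "\<And>n. H (Q n) \<le> m" "\<And>n. cost m (\<tau> n) z = Q n \<bullet> z - \<tau> n * H (Q n)" by metis
  have HQ: "l \<le> H (Q n)" for n
  proof -
    have "0 \<le> (s - \<tau> n) * (H (Q n) - l)"
      using nz[OF tau, of n] Q(2)[of n] cost_ge[OF Q(1), of n z s] by (simp add: algebra_simps)
    with tau(2)[of n] show ?thesis by (simp add: zero_le_mult_iff)
  qed
  obtain q r' where r': "strict_mono r'" and q: "(Q \<circ> r') \<longlonglongrightarrow> q" "H q \<le> m" using seq[of Q] Q(1) by blast
  have Hq: "l \<le> H q"
    by (rule LIMSEQ_le_const[OF Hlim[OF q(1)]]) (use HQ in auto)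
  have "(\<lambda>n. (Q \<circ> r') n \<bullet> z - (\<tau> \<circ> r') n * H ((Q \<circ> r') n) + l * (\<tau> \<circ> r') n) \<longlonglongrightarrow> q \<bullet> z - s * H q + l * s"
    by (intro tendsto_intros q Hlim LIMSEQ_subseq_LIMSEQ[OF taulim r'])
  then have qmax: "cost m s z \<le> q \<bullet> z - s * H q"
    using LIMSEQ_le_const[of _ "q \<bullet> z - s * H q + l * s" "cost m s z + l * s"] nz[OF tau] Q(2) by force
  have "continuous_on {0..1} (\<lambda>\<theta>. H ((1 - \<theta>) *\<^sub>R p + \<theta> *\<^sub>R q))"
    by (intro continuous_on_compose2[OF cont] continuous_intros) auto
  then obtain \<theta> where th: "0 \<le> \<theta>" "\<theta> \<le> 1" "H ((1 - \<theta>) *\<^sub>R p + \<theta> *\<^sub>R q) = l"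
    using IVT'[of "\<lambda>\<theta>. H ((1 - \<theta>) *\<^sub>R p + \<theta> *\<^sub>R q)" 0 l 1] Hp Hq by auto
  define k where "k = (1 - \<theta>) *\<^sub>R p + \<theta> *\<^sub>R q"
  have "s * l \<le> s * ((1 - \<theta>) * H p + \<theta> * H q)"
    using convexD[OF th(1,2), of p q] th(3) s by (intro mult_left_mono) auto
  moreover have "(1 - \<theta>) * cost m s z + \<theta> * cost m s z \<le> (1 - \<theta>) * (p \<bullet> z - s * H p) + \<theta> * (q \<bullet> z - s * H q)"
    using th qmax pmax by (intro add_mono mult_left_mono) auto
  ultimately have "cost m s z + l * s \<le> k \<bullet> z"
    by (simp add: k_def inner_add_left algebra_simps)
  also have "\<dots> \<le> cost l 0 z" using cost_ge[of k l z 0] th(3) by (simp add: k_def)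
  finally show ?thesis .
qed

text \<open>The easy half of an equality that holds at the points treated in
  \<open>cost_le_support_on_boundary\<close>.\<close>

lemma support_le_cost:
  assumes "0 \<le> l" "l \<le> m" "0 \<le> t"
  shows "cost l 0 z \<le> cost m t z + l * t"
proof (rule cost_le[OF assms(1)])
  fix p assume p: "H p \<le> l"
  have "t * H p \<le> l * t" using mult_left_mono[OF p assms(3)] by (simp add: mult.commute)
  with cost_ge[of p m z t] p assms(2) show "p \<bullet> z - 0 * H p \<le> cost m t z + l * t" by simp
qed

text \<open>The maximizers for such \<open>z\<close> and \<open>s\<close> satisfy \<open>H < l\<close>, hence can be moved by \<open>\<rho>\<close> in the
  direction of \<open>z\<close> without leaving \<open>{H \<le> m}\<close>.\<close>

lemma optimal_time_region_bounded:
  assumes "0 \<le> l" "l + 1 \<le> m"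
  obtains \<rho> where "0 < \<rho>"
    "\<And>l' s \<tau> z. l' \<le> l \<Longrightarrow> 0 \<le> \<tau> \<Longrightarrow> \<tau> < s \<Longrightarrow> cost m \<tau> z + l' * \<tau> < cost m s z + l' * s \<Longrightarrow> \<rho> * norm z \<le> s"
proof -
  have m: "0 \<le> m" using assms by linarith
  obtain R where R: "0 < R" "\<And>p. H p \<le> m \<Longrightarrow> norm p \<le> R" using cost_lipschitz[OF m] by metis
  have "uniformly_continuous_on (cball 0 (R + 1)) H"
    by (rule compact_uniformly_continuous[OF cont' compact_cball])
  then obtain d where d: "d > 0" "\<And>p q. norm p \<le> R + 1 \<Longrightarrow> norm q \<le> R + 1 \<Longrightarrow> dist q p < d \<Longrightarrow> dist (H q) (H p) < 1"
    unfolding uniformly_continuous_on_def by (metis mem_cball_0 zero_less_one)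
  \<comment> \<open>Within this distance \<open>H\<close> changes by less than 1, the gap between
    \<open>l\<close> and \<open>m\<close>; the bound by 1 keeps the moved point in the ball of
    radius \<open>R + 1\<close>.\<close>
  define \<rho> where "\<rho> = min 1 (d / 2)"
  have rho: "0 < \<rho>" "\<rho> \<le> 1" "\<rho> < d" using d(1) by (auto simp: \<rho>_def)
  show ?thesis
  proof (rule that[OF rho(1)])
    fix l' s \<tau> z assume *: "l' \<le> l" "0 \<le> \<tau>" "\<tau> < s" "cost m \<tau> z + l' * \<tau> < cost m s z + l' * s"
    show "\<rho> * norm z \<le> s"
    proof (cases "z = 0")
      case False
      obtain p where p: "H p \<le> m" "cost m s z = p \<bullet> z - s * H p"
        using cost_maximizer[OF m] by metis
      have "(s - \<tau>) * (H p - l') < 0" using *(4) p(2) cost_ge[OF p(1), of z \<tau>] by (simp add: algebra_simps)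
      with *(1,3) have Hp: "H p < l" by (simp add: mult_less_0_iff)
      define q where "q = p + (\<rho> / norm z) *\<^sub>R z"
      have nq: "norm (q - p) = \<rho>" using False rho(1) by (simp add: q_def)
      have "norm q \<le> R + 1" using norm_triangle_ineq[of p "q - p"] R(2)[OF p(1)] nq rho(2) by simp
      then have "dist (H q) (H p) < 1" using d(2)[of p q] R(2)[OF p(1)] nq rho(3) by (simp add: dist_norm)
      then have Hq: "H q \<le> H p + 1" by (simp add: dist_real_def abs_less_iff)
      with Hp assms(2) have "q \<bullet> z - s * H q \<le> cost m s z" by (intro cost_ge) linarith
      moreover have "q \<bullet> z = p \<bullet> z + \<rho> * norm z"
        using False by (simp add: q_def inner_add_left dot_square_norm power2_eq_square)
      moreover have "s * H q \<le> s * (H p + 1)" using Hq *(2,3) by (intro mult_left_mono) auto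
      ultimately show ?thesis unfolding p(2) by (simp add: algebra_simps)
    qed (use * in simp)
  qed
qed

end

section \<open>The convexity criterion\<close>

context hamiltonian
begin

text \<open>Comparison with cones. On the set \<open>W\<close> where \<open>u\<close> lies above the
  cone, the cone is an admissible competitor, so \<open>u\<close> cannot grow faster than it along
  segments in \<open>W\<close>. The ray from the vertex to \<open>x + z\<close> enters
  \<open>W\<close> for the last time at a point where \<open>u\<close> equals the cone, and the cone
  is linear along the ray.\<close>

lemma below_cone:
  assumes cmp: "segment_comparison H U u" and B: "cball x \<delta> \<subseteq> U" "continuous_on (cball x \<delta>) u"
    and l: "0 \<le> l" and R: "open R" "\<And>z. z \<in> R \<Longrightarrow> norm z \<le> \<delta> / 2" and "0 < \<delta>"
    and fr: "\<And>z. z \<in> closure R \<Longrightarrow> z \<notin> R \<Longrightarrow> u (x + z) \<le> u x + cost l 0 z"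
    and z: "z \<in> R"
  shows "u (x + z) \<le> u x + cost l 0 z"
proof (rule ccontr)
  assume nz: "\<not> u (x + z) \<le> u x + cost l 0 z"
  define w where "w y = u x + cost l 0 (y - x)" for y
  obtain L where L: "L-lipschitz_on UNIV (cost l 0)" using cost_lipschitz[OF l] by metis
  have wl: "L-lipschitz_on UNIV w"
  proof (rule lipschitz_onI)
    show "dist (w y) (w y') \<le> L * dist y y'" for y y'
      using lipschitz_onD[OF L, of "y - x" "y' - x"] by (simp add: w_def dist_norm)
  qed (rule lipschitz_on_nonneg[OF L])
  then have wc: "continuous_on S w" for S
    using lipschitz_on_continuous_on continuous_on_subset by blast
  define W where "W = {y \<in> ball x \<delta>. y - x \<in> R \<and> w y < u y}"
  have Wsub: "W \<subseteq> cball x (\<delta> / 2)" using R(2) by (auto simp: W_def dist_norm norm_minus_commute)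
  have uc: "continuous_on (ball x \<delta>) u" using B(2) ball_subset_cball continuous_on_subset by blast
  have "open W"
  proof -
    have "open (ball x \<delta> \<inter> (\<lambda>y. u y - w y) -` {0<..})"
      by (intro continuous_open_preimage continuous_intros uc wc) auto
    moreover have "open ((\<lambda>y. y - x) -` R)"
      by (intro open_vimage R continuous_intros)
    moreover have "W = (ball x \<delta> \<inter> (\<lambda>y. u y - w y) -` {0<..}) \<inter> ((\<lambda>y. y - x) -` R)"
      by (auto simp: W_def)
    ultimately show ?thesis by auto
  qed
  have clW: "closure W \<subseteq> cball x (\<delta> / 2)" using Wsub by (simp add: closure_minimal)
  then have clW': "closure W \<subseteq> ball x \<delta>" using \<open>0 < \<delta>\<close> by auto
  have "compact (closure W)"
    using compact_Int_closed[OF compact_cball closed_closure, of x "\<delta>/2" W] clW by (simp add: inf.absorb2)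
  moreover have "closure W \<subseteq> U" using clW' ball_subset_cball[of x \<delta>] B(1) by (meson order_trans)
  ultimately have WU: "W \<lless> U" using \<open>open W\<close> by (simp add: compactly_contained_def)
  have frW: "w y = u y" if y: "y \<in> closure W" "y \<notin> W" for y
  proof (rule antisym)
    have "continuous_on (closure W) (\<lambda>y. u y - w y)"
      by (intro continuous_intros wc continuous_on_subset[OF uc clW'])
    then have "0 \<le> u y - w y"
      by (rule continuous_ge_on_closure[OF _ y(1)]) (auto simp: W_def)
    then show "w y \<le> u y" by simp
    show "u y \<le> w y"
    proof (cases "y - x \<in> R")
      case True
      with y clW' show ?thesis by (auto simp: W_def not_less)
    next
      case False
      obtain Y where Y: "\<And>n::nat. Y n \<in> W" "Y \<longlonglongrightarrow> y" using y(1) unfolding closure_sequential by blast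
      have "(\<lambda>n. Y n - x) \<longlonglongrightarrow> y - x" by (intro tendsto_intros Y)
      moreover have "Y n - x \<in> R" for n using Y(1) by (auto simp: W_def)
      ultimately have "y - x \<in> closure R"
        unfolding closure_sequential by (intro exI[of _ "\<lambda>n. Y n - x"]) simp
      from fr[OF this False] show ?thesis by (simp add: w_def)
    qed
  qed
  have frW': "\<forall>y\<in>frontier W. w y = u y"
    using frW \<open>open W\<close> by (auto simp: frontier_def interior_open)
  define g where "g s = x + s *\<^sub>R z" for s :: real
  have gW: "g 1 \<in> W" using nz z R(2)[OF z] \<open>0 < \<delta>\<close> by (auto simp: g_def W_def w_def dist_norm)
  have g0: "g 0 \<notin> W" using l by (simp add: g_def W_def w_def cost_zero)
  have gc: "continuous_on S g" for S unfolding g_def by (intro continuous_intros)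
  \<comment> \<open>The largest parameter outside \<open>W\<close> is the last entrance. It exists
    because the vertex, where cone and \<open>u\<close> agree, is not in \<open>W\<close>.\<close>
  define S where "S = {0..1} \<inter> g -` (- W)"
  have "compact S" unfolding S_def
    by (intro compact_Int_closed compact_Icc closed_vimage gc) (use \<open>open W\<close> in auto)
  moreover have "0 \<in> S" using g0 by (simp add: S_def)
  ultimately obtain s where s: "s \<in> S" "\<And>r. r \<in> S \<Longrightarrow> r \<le> s"
    using compact_attains_sup[of S] by blast
  have s01: "0 \<le> s" "s < 1" using s(1) gW by (auto simp: S_def less_le)
  have inW: "g r \<in> W" if "s < r" "r \<le> 1" for r
    using s(2)[of r] that s01 by (force simp: S_def)
  have cls: "closure {s<..1} = {s..1}" using s01 by simp
  have "g s \<in> closure W"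
  proof -
    have "g ` closure {s<..1} \<subseteq> closure (g ` {s<..1})"
      by (rule image_closure_subset[OF gc]) (auto intro: closure_subset[THEN subsetD])
    also have "\<dots> \<subseteq> closure W" by (rule closure_mono) (use inW in auto)
    finally show ?thesis using s01 unfolding cls by auto
  qed
  moreover have "g s \<notin> W" using s(1) by (simp add: S_def)
  ultimately have "w (g s) = u (g s)" by (rule frW)
  moreover have "w (g s) = u x + s * cost l 0 z"
    using cost_scale[OF l, of s 0 z] s01(1) cost_zero[OF l]
    by (cases "s = 0") (auto simp: w_def g_def)
  ultimately have us: "u (g s) = u x + s * cost l 0 z" by simp
  \<comment> \<open>The comparison needs a segment inside the open set \<open>W\<close>, so it
    starts at \<open>r > s\<close>; continuity then permits \<open>r = s\<close>.\<close>
  have ge: "u (x + z) \<le> u (g r) + (1 - r) * cost l 0 z" if r: "r \<in> {s<..1}" for r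
  proof -
    have seg: "closed_segment (g r) (g 1) \<subseteq> W"
    proof
      fix y assume "y \<in> closed_segment (g r) (g 1)"
      then obtain k where k: "0 \<le> k" "k \<le> 1" "y = (1 - k) *\<^sub>R g r + k *\<^sub>R g 1"
        by (auto simp: closed_segment_def)
      then have "y = g ((1 - k) * r + k)" by (simp add: g_def algebra_simps)
      moreover have "s < (1 - k) * r + k"
      proof -
        have "(1 - k) * r + k = r + k * (1 - r)" by (simp add: algebra_simps)
        moreover have "0 \<le> k * (1 - r)" using r k by simp
        moreover have "s < r" using r by simp
        ultimately show ?thesis by linarith
      qed
      moreover have "(1 - k) * r + k \<le> 1"
        using mult_left_mono[of r 1 "1 - k"] r k by (simp add: algebra_simps)
      ultimately show "y \<in> W" using inW by simp
    qed
    have gd: "g 1 - g r = (1 - r) *\<^sub>R z" by (simp add: g_def algebra_simps)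
    have "u (g 1) - u (g r) \<le> cost l 0 (g 1 - g r)"
    proof -
      have "\<forall>y D. GDERIV w y :> D \<longrightarrow> H D \<le> l"
        using GDERIV_support_function[OF l] unfolding w_def by blast
      moreover have "\<forall>y\<in>W. w y \<le> u y" by (auto simp: W_def)
      moreover have "\<forall>p. H p \<le> l \<longrightarrow> p \<bullet> (g 1 - g r) \<le> cost l 0 (g 1 - g r)"
        using cost_ge[of _ l _ 0] by simp
      ultimately show ?thesis
        using cmp WU wl l frW' seg unfolding segment_comparison_def by blast
    qed
    also have "\<dots> = (1 - r) * cost l 0 z"
      using cost_scale[OF l, of "1 - r" 0 z] cost_zero[OF l] r unfolding gd
      by (cases "r = 1") auto
    finally show ?thesis by (simp add: g_def)
  qed
  have "g r \<in> closure W" if "r \<in> {s..1}" for r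
    using \<open>g s \<in> closure W\<close> inW[of r] closure_subset[of W] that by (cases "r = s") auto
  then have "g ` {s..1} \<subseteq> ball x \<delta>" using clW' by blast
  then have "continuous_on (closure {s<..1}) (\<lambda>r. u (g r) + (1 - r) * cost l 0 z)"
    unfolding cls by (intro continuous_intros continuous_on_compose2[OF uc gc]) simp_all
  then have "u (x + z) \<le> u (g s) + (1 - s) * cost l 0 z"
    by (rule continuous_ge_on_closure) (use ge s01 cls in auto)
  then show False using nz us by (simp add: algebra_simps)
qed

text \<open>With \<open>s = 2 * t\<close>, let \<open>k\<close> be the mean slope in time of the
  Hopf-Lax value between times 0 and \<open>s\<close>. It suffices that the value at time
  \<open>t\<close> is at most \<open>u x + k * t\<close>. Where time \<open>s\<close> is best, the
  inequality defining the value at \<open>s\<close> gives this; elsewhere the cone of level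
  \<open>k\<close> does.\<close>

lemma hopf_lax_convexity:
  assumes cmp: "segment_comparison H U u" and X: "X \<subseteq> U" "cball x \<delta> \<subseteq> X" "0 < \<delta>"
    and K: "0 \<le> K" "K-lipschitz_on X u"
    and l: "\<And>p. norm p \<le> K \<Longrightarrow> H p \<le> l" "l + 1 \<le> m"
    and rho: "0 < \<rho>" "\<And>l' s \<tau> z. l' \<le> l \<Longrightarrow> 0 \<le> \<tau> \<Longrightarrow> \<tau> < s \<Longrightarrow>
        cost m \<tau> z + l' * \<tau> < cost m s z + l' * s \<Longrightarrow> \<rho> * norm z \<le> s"
    and t: "0 < t" "4 * t \<le> \<rho> * \<delta>"
  shows "2 * hopf_lax X (\<lambda>x y. cost m t (y - x)) u x \<le> hopf_lax X (\<lambda>x y. cost m (2 * t) (y - x)) u x + u x"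
proof -
  have l0: "0 \<le> l" using l(1)[of 0] K(1) H0 by simp
  have m: "0 \<le> m" using l0 l(2) by simp
  define s where "s = 2 * t"
  have s: "0 < s" using t by (simp add: s_def)
  have x: "x \<in> X" using X by auto
  have up: "u y - cost m s (y - x) \<le> u x + s * l" if y: "y \<in> X" for y
  proof -
    have "u y - u x \<le> K * norm (y - x)"
      using lipschitz_onD[OF K(2) y x] by (simp add: dist_real_def dist_norm abs_le_iff)
    with cost_lower[OF l(1) _ K(1), of m s "y - x"] s l(2) show ?thesis by simp
  qed
  define M where "M = hopf_lax X (\<lambda>x y. cost m s (y - x)) u x"
  have bdd: "bdd_above ((\<lambda>y. u y - cost m s (y - x)) ` X)" using up by (rule bdd_aboveI2)
  have M: "u y - cost m s (y - x) \<le> M" if "y \<in> X" for y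
    unfolding M_def hopf_lax_def by (rule cSUP_upper[OF that bdd])
  have "M \<le> u x + s * l"
    unfolding M_def hopf_lax_def by (rule cSUP_least) (use x up in auto)
  moreover have "u x \<le> M" using M[OF x] cost_zero[OF m, of s] s by simp
  moreover define k where "k = (M - u x) / s"
  ultimately have k: "0 \<le> k" "k \<le> l" using s by (auto simp: pos_divide_le_eq mult.commute)
  have Mk: "M = u x + k * s" using s by (simp add: k_def)
  \<comment> \<open>Here \<open>s\<close> fails to minimize
    \<open>cost m \<tau> z + k * \<tau>\<close> over times in \<open>[0, s]\<close>. The condition
    \<open>4 * t \<le> \<rho> * \<delta>\<close> keeps this set within radius
    \<open>\<delta> / 2\<close>, so the cone comparison takes place inside \<open>X\<close>.\<close>
  define R where "R = {z. \<exists>\<tau>\<in>{0..<s}. cost m \<tau> z + k * \<tau> < cost m s z + k * s}"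
  have "open R"
  proof -
    have "R = (\<Union>\<tau>\<in>{0..<s}. {z. cost m \<tau> z + k * \<tau> < cost m s z + k * s})" by (auto simp: R_def)
    then show ?thesis by (auto intro!: open_Collect_less continuous_intros cost_continuous[OF m])
  qed
  have Rb: "norm z \<le> \<delta> / 2" if z: "z \<in> R" for z
  proof -
    obtain \<tau> where "0 \<le> \<tau>" "\<tau> < s" "cost m \<tau> z + k * \<tau> < cost m s z + k * s"
      using z by (auto simp: R_def)
    then have "\<rho> * norm z \<le> s" by (rule rho(2)[OF k(2)])
    also have "s \<le> \<rho> * (\<delta> / 2)" using t(2) by (simp add: s_def)
    finally show ?thesis using rho(1) by simp
  qed
  have below: "u y \<le> u x + (cost m t (y - x) + k * t)" if y: "y \<in> X" for y
  proof (cases "y - x \<in> R")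
    case True
    have "u (x + (y - x)) \<le> u x + cost k 0 (y - x)"
    proof (rule below_cone[OF cmp _ _ k(1) \<open>open R\<close> Rb X(3) _ True])
      show "cball x \<delta> \<subseteq> U" using X by simp
      show "continuous_on (cball x \<delta>) u"
        using lipschitz_on_continuous_on[OF K(2)] X(2) continuous_on_subset by blast
      fix z assume z: "z \<in> closure R" "z \<notin> R"
      have "closure R \<subseteq> cball 0 (\<delta> / 2)" by (rule closure_minimal) (use Rb in auto)
      then have "z \<in> cball 0 (\<delta> / 2)" using z(1) by blast
      then have "x + z \<in> X" using X(2,3) by (auto simp: subset_iff dist_norm)
      from M[OF this] have "u (x + z) \<le> u x + (cost m s z + k * s)" by (simp add: Mk)
      also have "cost m s z + k * s \<le> cost k 0 z"
        by (rule cost_le_support_on_boundary[OF m]) (use z s k l(2) in \<open>auto simp: R_def not_less\<close>)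
      finally show "u (x + z) \<le> u x + cost k 0 z" by simp
    qed
    also have "cost k 0 (y - x) \<le> cost m t (y - x) + k * t"
      by (rule support_le_cost) (use k l(2) t in auto)
    finally show ?thesis by simp
  next
    case False
    then have "cost m s (y - x) + k * s \<le> cost m t (y - x) + k * t"
      using t by (auto simp: R_def s_def not_less)
    with M[OF y] show ?thesis by (simp add: Mk)
  qed
  have "hopf_lax X (\<lambda>x y. cost m t (y - x)) u x \<le> u x + k * t"
    unfolding hopf_lax_def by (rule cSUP_least) (use x below in \<open>auto simp: algebra_simps\<close>)
  then have "2 * hopf_lax X (\<lambda>x y. cost m t (y - x)) u x \<le> M + u x" by (simp add: Mk s_def)
  then show ?thesis by (simp add: M_def s_def)
qed

end

section \<open>Comparison for discrete equations\<close>

lemma hopf_lax_ge: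
  assumes "bdd_above (w ` X)" "\<And>y. 0 \<le> c x y" "y \<in> X"
  shows "w y - c x y \<le> hopf_lax X c w x"
  unfolding hopf_lax_def
proof (rule cSUP_upper[OF assms(3)])
  obtain B where "\<And>y. y \<in> X \<Longrightarrow> w y \<le> B" using assms(1) unfolding bdd_above_def by blast
  then show "bdd_above ((\<lambda>y. w y - c x y) ` X)"
    using assms(2) by (intro bdd_aboveI2[of _ _ B]) (metis diff_left_mono diff_zero order_trans)
qed

lemma hopf_lax_le:
  assumes "X \<noteq> {}" "\<And>y. y \<in> X \<Longrightarrow> w y - c x y \<le> b"
  shows "hopf_lax X c w x \<le> b"
  unfolding hopf_lax_def by (rule cSUP_least) (use assms in auto)

lemma hopf_lax_approx:
  assumes "X \<noteq> {}" "0 < e"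
  shows "\<exists>y\<in>X. hopf_lax X c w x - e < w y - c x y"
proof (rule ccontr)
  assume "\<not> ?thesis"
  then have "hopf_lax X c w x \<le> hopf_lax X c w x - e"
    using assms(1) by (intro hopf_lax_le) (auto simp: not_less)
  with assms(2) show False by simp
qed

text \<open>The subtracted term is minus the lower operator \<open>INF y\<in>X. w y + c y x\<close>, so this is the
  nonnegativity of a second difference.\<close>

definition discrete_subsolution :: "'a set \<Rightarrow> 'a set \<Rightarrow> ('a \<Rightarrow> 'a \<Rightarrow> real) \<Rightarrow> ('a \<Rightarrow> real) \<Rightarrow> bool"
  where "discrete_subsolution X I c w \<longleftrightarrow>
    (\<forall>x\<in>I. 2 * w x \<le> hopf_lax X c w x - hopf_lax X (\<lambda>x y. c y x) (\<lambda>y. - w y) x)"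

text \<open>From a near-maximum of \<open>w - z\<close>, a near-optimal step for \<open>w\<close> leads to another near-maximum,
  where \<open>w\<close> is larger by about \<open>g\<close>. This cannot be repeated forever.\<close>

lemma discrete_comparison_strict:
  assumes c: "\<And>x y. 0 \<le> c x y" and IX: "I \<subseteq> X"
    and w: "bounded (w ` X)" "discrete_subsolution X I c w"
    and z: "bounded (z ` X)" "discrete_subsolution X I (\<lambda>x y. c y x) (\<lambda>y. - z y)"
    and g: "0 < g" "\<And>x. x \<in> I \<Longrightarrow> w x + g \<le> hopf_lax X c w x"
    and b: "\<And>x. x \<in> X \<Longrightarrow> x \<notin> I \<Longrightarrow> w x - z x \<le> b" and x: "x \<in> X"
  shows "w x - z x \<le> b"
proof (rule ccontr)
  assume xb: "\<not> w x - z x \<le> b"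
  have X: "X \<noteq> {}" using x by blast
  obtain B where B: "\<And>y. y \<in> X \<Longrightarrow> \<bar>w y\<bar> \<le> B" using w(1) by (auto simp: bounded_iff)
  obtain C where C: "\<And>y. y \<in> X \<Longrightarrow> \<bar>z y\<bar> \<le> C" using z(1) by (auto simp: bounded_iff)
  have bw: "bdd_above (w ` X)" using B by (intro bdd_aboveI2[of _ _ B]) (auto simp: abs_le_iff)
  have bw': "bdd_above ((\<lambda>y. - w y) ` X)" using B by (intro bdd_aboveI2[of _ _ B]) (auto simp: abs_le_iff)
  have bz: "bdd_above (z ` X)" using C by (intro bdd_aboveI2[of _ _ C]) (auto simp: abs_le_iff)
  have bd: "bdd_above ((\<lambda>y. w y - z y) ` X)"
    using B C by (intro bdd_aboveI2[of _ _ "B + C"]) (fastforce simp: abs_le_iff)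
  define m where "m = (SUP y\<in>X. w y - z y)"
  have m: "w y - z y \<le> m" if "y \<in> X" for y unfolding m_def by (rule cSUP_upper[OF that bd])
  have bm: "b < m" using m[OF x] xb by simp
  have step: "\<exists>y\<in>X. w y - z y \<ge> m - 3 * e \<and> w y \<ge> w x + g - e"
    if x: "x \<in> X" "w x - z x \<ge> m - e" and e: "0 < e" "e < m - b" for x e
  proof -
    have "x \<in> I" using b[of x] x e by fastforce
    let ?Tw = "hopf_lax X c w x" and ?Tz = "hopf_lax X c z x"
    let ?Sw = "hopf_lax X (\<lambda>x y. c y x) (\<lambda>y. - w y) x" and ?Sz = "hopf_lax X (\<lambda>x y. c y x) (\<lambda>y. - z y) x"
    have "?Sz + z x - e - w x \<le> ?Sw"
    proof -
      have "?Sz \<le> ?Sw - z x + e + w x"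
      proof (rule hopf_lax_le[OF X])
        fix y assume y: "y \<in> X"
        from hopf_lax_ge[where c = "\<lambda>x y. c y x" and x = x, OF bw' c y] m[OF y] x(2)
        show "- z y - c y x \<le> ?Sw - z x + e + w x" by simp
      qed
      then show ?thesis by simp
    qed
    moreover have "2 * w x \<le> ?Tw - ?Sw" using w(2) \<open>x \<in> I\<close> by (auto simp: discrete_subsolution_def)
    moreover have "2 * (- z x) \<le> ?Sz - ?Tz" using z(2) \<open>x \<in> I\<close> by (auto simp: discrete_subsolution_def)
    \<comment> \<open>The near-maximum bounds the downward increment of \<open>w\<close> below by
      that of \<open>z\<close>, up to \<open>e\<close>; the two second-difference inequalities turn
      this into a comparison of upward increments.\<close>
    ultimately have T: "?Tz - z x \<le> ?Tw - w x + e" by simp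
    obtain y where y: "y \<in> X" "?Tw - e < w y - c x y" using hopf_lax_approx[OF X e(1)] by blast
    have "z y - c x y \<le> ?Tz" by (rule hopf_lax_ge[OF bz c y(1)])
    with T y(2) x(2) have "w y - z y \<ge> m - 3 * e" by linarith
    moreover have "w y \<ge> w x + g - e" using g(2)[OF \<open>x \<in> I\<close>] y(2) c[of x y] by linarith
    ultimately show ?thesis using y(1) by blast
  qed
  \<comment> \<open>Each step triples the defect from the maximum, so the induction must allow every
    \<open>e\<close> at once.\<close>
  have "\<exists>y\<in>X. w y - z y \<ge> m - e \<and> w y \<ge> - B + real n * (g / 2)" if "0 < e" for n e
    using that
  proof (induction n arbitrary: e)
    case 0
    have "\<exists>y\<in>X. m - e < w y - z y"
      using less_cSUP_iff[OF X bd, of "m - e"] 0 by (simp add: m_def)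
    then show ?case using B by (force simp: abs_le_iff)
  next
    case (Suc n)
    \<comment> \<open>Three demands: tripling stays below \<open>e\<close>, the net gain is at least
      \<open>g / 2\<close>, and the point stays in \<open>I\<close> because its difference exceeds
      \<open>b\<close>.\<close>
    define e' where "e' = min (e / 3) (min (g / 2) ((m - b) / 2))"
    have e': "0 < e'" "3 * e' \<le> e" "e' \<le> g / 2" "e' < m - b"
      using Suc.prems g(1) bm by (auto simp: e'_def min_def)
    obtain y where y: "y \<in> X" "w y - z y \<ge> m - e'" "w y \<ge> - B + real n * (g / 2)"
      using Suc.IH[OF e'(1)] by blast
    obtain y' where "y' \<in> X" "w y' - z y' \<ge> m - 3 * e'" "w y' \<ge> w y + g - e'"
      using step[OF y(1,2) e'(1,4)] by blast
    with y(3) e' show ?case by (intro bexI[of _ y']) (auto simp: algebra_simps)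
  qed
  from this[OF zero_less_one] have "real n * (g / 2) \<le> 2 * B" for n
    using B by (smt (verit) abs_le_iff)
  moreover obtain n where "2 * B < real n * (g / 2)"
    using reals_Archimedean3[of "g/2"] g(1) by (metis half_gt_zero)
  ultimately show False by (meson not_less)
qed

text \<open>On the set \<open>V\<close> where \<open>w\<close> grows by at most \<open>g\<close>, replace it by the smallest function (an infimum
  over the class \<open>F\<close>) that falls short of its Hopf-Lax value by at most \<open>g\<close>; minimality forces
  equality. The chains \<open>x, \<sigma> x, \<sigma> (\<sigma> x), \<dots>\<close> leaving \<open>I\<close> bound the loss from below.\<close>

lemma discrete_patching:
  assumes c: "\<And>x y. 0 \<le> c x y" and IX: "I \<subseteq> X"
    and w: "bounded (w ` X)" "discrete_subsolution X I c w"
    and g: "0 < g" and kappa: "0 \<le> \<kappa>"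
    and esc: "\<And>x. x \<in> I \<Longrightarrow> \<sigma> x \<in> X" "\<And>x. x \<in> I \<Longrightarrow> k (\<sigma> x) < (k x :: nat)"
      "\<And>x. x \<in> I \<Longrightarrow> c x (\<sigma> x) + c (\<sigma> x) x \<le> \<kappa>"
    and k: "\<And>x. x \<in> X \<Longrightarrow> real (k x) * (\<kappa> + 2 * g) \<le> e"
  obtains v where "bounded (v ` X)" "discrete_subsolution X I c v"
    "\<And>x. x \<in> I \<Longrightarrow> v x + g \<le> hopf_lax X c v x"
    "\<And>x. x \<in> X \<Longrightarrow> x \<notin> I \<Longrightarrow> v x = w x"
    "\<And>x. x \<in> X \<Longrightarrow> v x \<le> w x" "\<And>x. x \<in> X \<Longrightarrow> w x - e \<le> v x"
proof (cases "X = {}")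
  case True
  then show ?thesis using IX by (intro that[of w]) (use w in auto)
next
  case X: False
  let ?T = "hopf_lax X c" and ?S = "\<lambda>w. hopf_lax X (\<lambda>x y. c y x) (\<lambda>y. - w y)"
  obtain B where B: "\<And>y. y \<in> X \<Longrightarrow> \<bar>w y\<bar> \<le> B" using w(1) by (auto simp: bounded_iff)
  have bw: "bdd_above (w ` X)" using B by (intro bdd_aboveI2[of _ _ B]) (auto simp: abs_le_iff)
  have bw': "bdd_above ((\<lambda>y. - w y) ` X)" using B by (intro bdd_aboveI2[of _ _ B]) (auto simp: abs_le_iff)
  have sub: "2 * w x \<le> ?T w x - ?S w x" if "x \<in> I" for x
    using w(2) that by (auto simp: discrete_subsolution_def)
  have Tge: "w y - c x y \<le> ?T w x" if "y \<in> X" for x y by (rule hopf_lax_ge[OF bw c that])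
  have Sge: "- w y - c y x \<le> ?S w x" if "y \<in> X" for x y
    by (rule hopf_lax_ge[where c = "\<lambda>x y. c y x" and x = x, OF bw' c that])
  define V where "V = {x \<in> I. ?T w x \<le> w x + g}"
  define F where "F = {f. (\<forall>x\<in>X - V. f x = w x) \<and> (\<forall>x\<in>V. \<forall>y\<in>X. f y - c x y - g \<le> f x)}"
  have VX: "V \<subseteq> X" using IX by (auto simp: V_def)
  have wF: "w \<in> F"
    unfolding F_def
  proof (intro CollectI conjI ballI)
    fix x y assume "x \<in> V" "y \<in> X"
    from Tge[OF this(2), of x] this(1) show "w y - c x y - g \<le> w x" by (simp add: V_def)
  qed simp
  \<comment> \<open>At points of \<open>V\<close> the upward increment is at most \<open>g\<close>,
    and the second-difference inequality passes this bound to the downward increment.\<close>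
  have V_drop: "w x \<le> w y + c y x + g" if "x \<in> V" "y \<in> X" for x y
    using Sge[OF that(2), of x] sub[of x] that(1) by (auto simp: V_def)
  \<comment> \<open>One step of the chain loses at most \<open>\<kappa> + 2 * g\<close>: one
    \<open>g\<close> from membership in \<open>F\<close>, another from \<open>V_drop\<close>, and
    the two costs between \<open>x\<close> and \<open>\<sigma> x\<close>.\<close>
  have lower: "w x - real (k x) * (\<kappa> + 2 * g) \<le> f x" if f: "f \<in> F" and "x \<in> X" for f x
    using \<open>x \<in> X\<close>
  proof (induction "k x" arbitrary: x rule: less_induct)
    case less
    show ?case
    proof (cases "x \<in> V")
      case True
      then have xI: "x \<in> I" by (simp add: V_def)
      let ?y = "\<sigma> x"
      note y = esc(1)[OF xI]
      have IH: "w ?y - real (k ?y) * (\<kappa> + 2 * g) \<le> f ?y" by (rule less.hyps[OF esc(2)[OF xI] y])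
      have "f ?y - c x ?y - g \<le> f x" using f True y by (auto simp: F_def)
      moreover note V_drop[OF True y]
      ultimately have "w x - (\<kappa> + 2 * g) - real (k ?y) * (\<kappa> + 2 * g) \<le> f x"
        using IH esc(3)[OF xI] by linarith
      moreover have "(real (k ?y) + 1) * (\<kappa> + 2 * g) \<le> real (k x) * (\<kappa> + 2 * g)"
        using esc(2)[OF xI] kappa g by (intro mult_right_mono) auto
      ultimately show ?thesis by (simp add: algebra_simps)
    next
      case False
      have "0 \<le> real (k x) * (\<kappa> + 2 * g)" using kappa g by simp
      then show ?thesis using f less.prems False by (auto simp: F_def)
    qed
  qed
  have lower': "w x - e \<le> f x" if "f \<in> F" "x \<in> X" for f x
    using lower[OF that] k[OF that(2)] by linarith
  define v where "v x = (INF f\<in>F. f x)" for x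
  have bdd: "bdd_below ((\<lambda>f. f x) ` F)" if "x \<in> X" for x
    using lower'[OF _ that] by (rule bdd_belowI2)
  have v_le: "v x \<le> f x" if "f \<in> F" "x \<in> X" for f x
    unfolding v_def by (rule cINF_lower[OF bdd[OF that(2)] that(1)])
  have v_ge: "b \<le> v x" if "\<And>f. f \<in> F \<Longrightarrow> b \<le> f x" for b x
    unfolding v_def by (rule cINF_greatest) (use wF that in auto)
  have vw: "v x \<le> w x" if "x \<in> X" for x using v_le[OF wF that] .
  have wv: "w x - e \<le> v x" if "x \<in> X" for x using lower'[OF _ that] by (rule v_ge)
  have v_out: "v x = w x" if "x \<in> X - V" for x
  proof (rule antisym)
    show "w x \<le> v x" by (rule v_ge) (use that in \<open>auto simp: F_def\<close>)
  qed (use vw that in auto)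
  have v_in: "v y - c x y - g \<le> v x" if "x \<in> V" "y \<in> X" for x y
  proof (rule v_ge)
    fix f assume f: "f \<in> F"
    then have "f y - c x y - g \<le> f x" using that by (auto simp: F_def)
    with v_le[OF f that(2)] show "v y - c x y - g \<le> f x" by linarith
  qed
  have bv: "bdd_above (v ` X)" using vw B by (intro bdd_aboveI2[of _ _ B]) (fastforce simp: abs_le_iff)
  have Tvge: "v y - c x y \<le> ?T v x" if "y \<in> X" for x y by (rule hopf_lax_ge[OF bv c that])
  have Tv_V: "?T v x = v x + g" if x: "x \<in> V" for x
  proof (rule antisym)
    show le: "?T v x \<le> v x + g"
      by (rule hopf_lax_le[OF X]) (use v_in[OF x] in \<open>fastforce simp: algebra_simps\<close>)
    \<comment> \<open>If the growth were less than \<open>g\<close> at \<open>x\<close>, lowering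
      \<open>v\<close> at this one point would give a smaller member of \<open>F\<close>.\<close>
    define f where "f = v(x := ?T v x - g)"
    have fv: "f y \<le> v y" for y using le by (simp add: f_def)
    have "f \<in> F"
      unfolding F_def
    proof (intro CollectI conjI ballI)
      fix y assume "y \<in> X - V"
      then show "f y = w y" using x v_out by (auto simp: f_def)
    next
      fix x' y assume *: "x' \<in> V" "y \<in> X"
      show "f y - c x' y - g \<le> f x'"
      proof (cases "x' = x")
        case True
        then show ?thesis using fv[of y] Tvge[OF *(2), of x] by (simp add: f_def)
      next
        case False
        then show ?thesis using fv[of y] v_in[OF *] by (simp add: f_def)
      qed
    qed
    then have "v x \<le> f x" using x VX by (intro v_le) auto
    then show "v x + g \<le> ?T v x" by (simp add: f_def)
  qed
  have TwTv: "?T w x \<le> ?T v x" if x: "x \<in> I" "x \<notin> V" for x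
  proof (rule field_le_epsilon)
    fix \<eta> :: real assume "0 < \<eta>"
    define \<eta>' where "\<eta>' = min \<eta> (?T w x - w x - g)"
    have eta: "0 < \<eta>'" "\<eta>' \<le> \<eta>" "\<eta>' \<le> ?T w x - w x - g" using \<open>0 < \<eta>\<close> x by (auto simp: \<eta>'_def V_def)
    obtain y where y: "y \<in> X" "?T w x - \<eta>' < w y - c x y" using hopf_lax_approx[OF X eta(1)] by blast
    \<comment> \<open>By the choice of \<open>\<eta>'\<close> the step to \<open>y\<close> raises
      \<open>w\<close> by more than \<open>g + c x y\<close>, which \<open>V_drop\<close> forbids
      for a target in \<open>V\<close>. Hence the modification leaves \<open>w y\<close>
      unchanged.\<close>
    have "y \<notin> V" using V_drop[of y x] x(1) IX y(2) eta(3) by force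
    then have "v y = w y" using y(1) v_out by simp
    with Tvge[OF y(1), of x] y(2) eta(2) show "?T w x \<le> ?T v x + \<eta>" by linarith
  qed
  have grow: "v x + g \<le> ?T v x" if "x \<in> I" for x
  proof (cases "x \<in> V")
    case False
    then show ?thesis using TwTv[OF that False] that vw[of x] IX by (force simp: V_def)
  qed (simp add: Tv_V)
  have V_bound: "- v y - c y x \<le> g - v x" if "y \<in> V" "x \<in> X" for x y
    using v_in[OF that] by simp
  have "discrete_subsolution X I c v"
    unfolding discrete_subsolution_def
  proof
    fix x assume x: "x \<in> I"
    have xX: "x \<in> X" using x IX by blast
    have "?S v x \<le> ?T v x - 2 * v x"
    proof (rule hopf_lax_le[OF X])
      fix y assume y: "y \<in> X"
      show "- v y - c y x \<le> ?T v x - 2 * v x"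
      proof (cases "y \<in> V")
        case True
        then show ?thesis using V_bound[OF True xX] grow[OF x] by simp
      next
        case yV: False
        then have vy: "v y = w y" using y v_out by simp
        show ?thesis
        proof (cases "x \<in> V")
          case True
          then show ?thesis using V_drop[OF True y] vw[OF xX] Tv_V[OF True] vy by simp
        next
          case False
          then show ?thesis using Sge[OF y, of x] sub[OF x] TwTv[OF x False] vy v_out[of x] xX by simp
        qed
      qed
    qed
    then show "2 * v x \<le> ?T v x - ?S v x" by simp
  qed
  moreover have "bounded (v ` X)"
    unfolding bounded_iff
  proof (intro exI ballI)
    fix r assume "r \<in> v ` X"
    then obtain x where "x \<in> X" "r = v x" by blast
    then show "norm r \<le> B + \<bar>e\<bar>" using vw[of x] wv[of x] B[of x] by (simp add: abs_le_iff)
  qed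
  moreover have "v x = w x" if "x \<in> X" "x \<notin> I" for x using that v_out by (simp add: V_def)
  ultimately show ?thesis using that grow vw wv by blast
qed

text \<open>Patching makes the strict comparison applicable at a loss of \<open>e\<close>, which is
  arbitrary because points of \<open>I\<close> can leave it by chains of arbitrarily small total
  cost.\<close>

theorem discrete_comparison:
  assumes c: "\<And>x y. 0 \<le> c x y" and IX: "I \<subseteq> X"
    and w: "bounded (w ` X)" "discrete_subsolution X I c w"
    and z: "bounded (z ` X)" "discrete_subsolution X I (\<lambda>x y. c y x) (\<lambda>y. - z y)"
    and esc: "\<And>e. 0 < e \<Longrightarrow> \<exists>\<sigma> (k :: 'a \<Rightarrow> nat) N \<kappa>. 0 \<le> \<kappa> \<and> real N * \<kappa> < e \<and> (\<forall>x\<in>X. k x \<le> N)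
      \<and> (\<forall>x\<in>I. \<sigma> x \<in> X \<and> k (\<sigma> x) < k x \<and> c x (\<sigma> x) + c (\<sigma> x) x \<le> \<kappa>)"
    and b: "\<And>x. x \<in> X \<Longrightarrow> x \<notin> I \<Longrightarrow> w x - z x \<le> b" and x: "x \<in> (X :: 'a set)"
  shows "w x - z x \<le> b"
proof (rule field_le_epsilon)
  fix e :: real assume e: "0 < e"
  from esc[OF e] obtain \<sigma> and k :: "'a \<Rightarrow> nat" and N \<kappa> where
    *: "0 \<le> \<kappa>" "real N * \<kappa> < e" "\<And>x. x \<in> X \<Longrightarrow> k x \<le> N"
    "\<And>x. x \<in> I \<Longrightarrow> \<sigma> x \<in> X" "\<And>x. x \<in> I \<Longrightarrow> k (\<sigma> x) < k x"
    "\<And>x. x \<in> I \<Longrightarrow> c x (\<sigma> x) + c (\<sigma> x) x \<le> \<kappa>"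
    by blast
  \<comment> \<open>Chosen so that \<open>N\<close> steps of loss \<open>\<kappa> + 2 * g\<close>
    fit into \<open>e\<close>; the added 1 avoids a zero denominator when
    \<open>N = 0\<close>.\<close>
  define g where "g = (e - real N * \<kappa>) / (2 * real N + 1)"
  have g: "0 < g" using *(2) by (simp add: g_def)
  have "g * (2 * real N + 1) = e - real N * \<kappa>" by (simp add: g_def add_nonneg_eq_0_iff)
  then have "real N * (\<kappa> + 2 * g) \<le> e" using g by (simp add: algebra_simps)
  moreover have "real (k x) * (\<kappa> + 2 * g) \<le> real N * (\<kappa> + 2 * g)" if "x \<in> X" for x
    using *(3)[OF that] *(1) g by (intro mult_right_mono) auto
  ultimately have k: "real (k x) * (\<kappa> + 2 * g) \<le> e" if "x \<in> X" for x
    using that by (meson order_trans)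
  obtain v where v: "bounded (v ` X)" "discrete_subsolution X I c v"
    "\<And>x. x \<in> I \<Longrightarrow> v x + g \<le> hopf_lax X c v x" "\<And>x. x \<in> X \<Longrightarrow> x \<notin> I \<Longrightarrow> v x = w x"
    "\<And>x. x \<in> X \<Longrightarrow> v x \<le> w x" "\<And>x. x \<in> X \<Longrightarrow> w x - e \<le> v x"
    using discrete_patching[where k = k and \<sigma> = \<sigma> and c = c, OF c IX w g *(1) *(4,5,6) k] by blast
  have "v x - z x \<le> b"
    by (rule discrete_comparison_strict[OF c IX v(1,2) z g v(3) _ x]) (use b v(4) in auto)
  with v(6)[OF x] show "w x - z x \<le> b + e" by linarith
qed

section \<open>Uniqueness\<close>

lemma hamiltonian_reflect:
  assumes "hamiltonian H"
  shows "hamiltonian (\<lambda>p. H (- p))"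
proof -
  interpret hamiltonian H by fact
  show ?thesis
  proof
    show "convex_on UNIV (\<lambda>p. H (- p))"
    proof (rule convex_onI)
      fix t :: real and p q :: "real ^ 'a"
      assume "0 < t" "t < 1"
      then show "H (- ((1 - t) *\<^sub>R p + t *\<^sub>R q)) \<le> (1 - t) * H (- p) + t * H (- q)"
        using convexD[of t "- p" "- q"] by simp
    qed simp
    show "bounded {p. H (- p) = 0}"
      using bdd0 unfolding bounded_iff by (metis mem_Collect_eq norm_minus_cancel)
  qed (use H0 nonneg in auto)
qed

context hamiltonian
begin

lemma cost_reflect:
  assumes "0 \<le> m"
  shows "hamiltonian.cost (\<lambda>p. H (- p)) m t z = cost m t (- z)"
proof -
  interpret r: hamiltonian "\<lambda>p. H (- p)"
    by (rule hamiltonian_reflect) (rule hamiltonian_axioms)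
  show ?thesis
  proof (rule antisym)
    show "r.cost m t z \<le> cost m t (- z)"
    proof (rule r.cost_le[OF assms])
      fix p assume "H (- p) \<le> m"
      from cost_ge[OF this, of "- z" t] show "p \<bullet> z - t * H (- p) \<le> cost m t (- z)" by simp
    qed
    show "cost m t (- z) \<le> r.cost m t z"
    proof (rule cost_le[OF assms])
      fix p assume "H p \<le> m"
      with r.cost_ge[of "- p" m z t] show "p \<bullet> - z - t * H p \<le> r.cost m t z" by simp
    qed
  qed
qed

section \<open>From the Hopf-Lax step to discrete subsolutions\<close>

lemma hopf_lax_bounds:
  assumes K: "K-lipschitz_on X u" and l: "\<And>p. norm p \<le> K \<Longrightarrow> H p \<le> l" "l \<le> m" and "0 \<le> t" and x: "x \<in> X"
  shows "u x \<le> hopf_lax X (\<lambda>x y. cost m t (y - x)) u x"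
    and "hopf_lax X (\<lambda>x y. cost m t (y - x)) u x \<le> u x + t * l"
    and "bdd_above ((\<lambda>y. u y - cost m t (y - x)) ` X)"
proof -
  have K0: "0 \<le> K" using K by (rule lipschitz_on_nonneg)
  have m: "0 \<le> m" using l(1)[of 0] l(2) K0 H0 by simp
  have le: "u y - cost m t (y - x) \<le> u x + t * l" if y: "y \<in> X" for y
  proof -
    have "u y - u x \<le> K * norm (y - x)"
      using lipschitz_onD[OF K y x] by (simp add: dist_real_def dist_norm abs_le_iff)
    with cost_lower[OF l(1) l(2) K0 \<open>0 \<le> t\<close>, of "y - x"] show ?thesis by simp
  qed
  show bdd: "bdd_above ((\<lambda>y. u y - cost m t (y - x)) ` X)" using le by (rule bdd_aboveI2)
  show "u x \<le> hopf_lax X (\<lambda>x y. cost m t (y - x)) u x"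
    unfolding hopf_lax_def using cSUP_upper[OF x bdd] cost_zero[OF m \<open>0 \<le> t\<close>] by simp
  show "hopf_lax X (\<lambda>x y. cost m t (y - x)) u x \<le> u x + t * l"
    by (rule hopf_lax_le) (use x le in auto)
qed

text \<open>For \<open>w\<close> the Hopf-Lax value of \<open>u\<close> at time \<open>t\<close>, a
  second step upwards gains at least as much as one step of time \<open>2 * t\<close> from
  \<open>u\<close>, while the step downwards cannot fall below \<open>u x\<close>. Thus midpoint
  convexity in time becomes the second-difference inequality for \<open>w\<close>.\<close>

lemma hopf_lax_subsolution:
  assumes cmp: "segment_comparison H U u" and X: "X \<subseteq> U" "\<And>x. x \<in> I \<Longrightarrow> cball x d \<subseteq> X" "0 < d"
    and K: "K-lipschitz_on X u" and l: "\<And>p. norm p \<le> K + 1 \<Longrightarrow> H p \<le> l" "l + 1 \<le> m"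
  obtains t0 where "0 < t0" "\<And>t. 0 < t \<Longrightarrow> t < t0 \<Longrightarrow>
    discrete_subsolution X I (\<lambda>x y. cost m t (y - x)) (hopf_lax X (\<lambda>x y. cost m t (y - x)) u)"
proof -
  have K0: "0 \<le> K" using K by (rule lipschitz_on_nonneg)
  have l0: "0 \<le> l" using l(1)[of 0] K0 H0 by simp
  have m: "0 \<le> m" "l \<le> m" using l0 l(2) by auto
  have lK: "H p \<le> l" if "norm p \<le> K" for p using l(1) that by simp
  obtain \<rho> where rho: "0 < \<rho>" "\<And>l' s \<tau> z. l' \<le> l \<Longrightarrow> 0 \<le> \<tau> \<Longrightarrow> \<tau> < s \<Longrightarrow>
      cost m \<tau> z + l' * \<tau> < cost m s z + l' * s \<Longrightarrow> \<rho> * norm z \<le> s"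
    using optimal_time_region_bounded[OF l0 l(2)] by metis
  \<comment> \<open>The first bound serves the cone comparison in balls of radius \<open>d\<close>;
    the second gives \<open>t * (2 * l + 1) < d\<close>, the distance bound for
    near-maximizers.\<close>
  define t0 where "t0 = min (\<rho> * d / 4) (d / (2 * l + 1))"
  have "0 < t0" using rho(1) X(3) l0 by (simp add: t0_def)
  moreover have "discrete_subsolution X I (\<lambda>x y. cost m t (y - x)) (hopf_lax X (\<lambda>x y. cost m t (y - x)) u)"
    if t: "0 < t" "t < t0" for t
    unfolding discrete_subsolution_def
  proof
    fix x assume x: "x \<in> I"
    let ?c = "\<lambda>x y. cost m t (y - x)" and ?c2 = "\<lambda>x y. cost m (2 * t) (y - x)"
    let ?w = "hopf_lax X ?c u"
    have t1: "4 * t \<le> \<rho> * d" and "t < d / (2 * l + 1)" using t by (auto simp: t0_def)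
    then have t2: "2 * t * l + t < d" using l0 by (simp add: pos_less_divide_eq algebra_simps)
    have xX: "x \<in> X" using X(2)[OF x] X(3) by auto
    have upper: "?w y \<le> u y + t * l" and bdd: "bdd_above ((\<lambda>z. u z - ?c y z) ` X)" if "y \<in> X" for y
      using hopf_lax_bounds[OF K _ m(2) _ that, of t] lK t by auto
    have lower2: "u x \<le> hopf_lax X ?c2 u x"
      by (rule hopf_lax_bounds(1)[OF K _ m(2) _ xX]) (use lK t in auto)
    have conv: "2 * ?w x \<le> hopf_lax X ?c2 u x + u x"
      by (rule hopf_lax_convexity[OF cmp X(1) X(2)[OF x] X(3) K0 K lK l(2) rho t(1) t1])
    have bw: "?w y - ?c x' y \<le> hopf_lax X ?c ?w x'" if "x' \<in> X" "y \<in> X" for x' y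
    proof -
      have "?w y' - ?c x' y' \<le> u x' + (t + t) * l" if y': "y' \<in> X" for y'
      proof -
        have "u y' - u x' \<le> K * norm (y' - x')"
          using lipschitz_onD[OF K y' \<open>x' \<in> X\<close>] by (simp add: dist_real_def dist_norm abs_le_iff)
        with cost_lower[OF lK m(2) K0 less_imp_le[OF t(1)], of "y' - x'"] upper[OF y']
        show ?thesis by (simp add: algebra_simps)
      qed
      then have "bdd_above ((\<lambda>y. ?w y - ?c x' y) ` X)" by (rule bdd_aboveI2)
      then show ?thesis unfolding hopf_lax_def[of X ?c ?w] by (rule cSUP_upper[OF that(2)])
    qed
    have "hopf_lax X ?c2 u x \<le> hopf_lax X ?c ?w x"
    proof (rule field_le_epsilon)
      fix e :: real assume "0 < e"
      define e' where "e' = min e t"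
      have e': "0 < e'" "e' \<le> e" "e' \<le> t" using \<open>0 < e\<close> t by (auto simp: e'_def)
      obtain z where z: "z \<in> X" "hopf_lax X ?c2 u x - e' < u z - ?c2 x z"
        using hopf_lax_approx[of X e' ?c2 u x] e'(1) xX by blast
      have "u z - u x \<le> K * norm (z - x)"
        using lipschitz_onD[OF K z(1) xX] by (simp add: dist_real_def dist_norm abs_le_iff)
      \<comment> \<open>The surplus slope 1 over the Lipschitz constant confines \<open>z\<close> to
        distance \<open>2 * t * l + t\<close> from \<open>x\<close>.\<close>
      moreover have "(K + 1) * norm (z - x) - (2 * t) * l \<le> cost m (2 * t) (z - x)"
        by (rule cost_lower[OF l(1) m(2)]) (use K0 t in auto)
      ultimately have "norm (z - x) \<le> 2 * t * l + t"
        using lower2 z(2) e'(3) by (simp add: algebra_simps)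
      then have zx: "norm (z - x) < d" using t2 by simp
      \<comment> \<open>The step of time \<open>2 * t\<close> is split at the midpoint, where
        homogeneity divides the cost equally. As \<open>X\<close> need not be convex, the midpoint
        lies in \<open>X\<close> only because \<open>z\<close> is close to \<open>x\<close>.\<close>
      define h where "h = (1/2) *\<^sub>R (z - x)"
      define y where "y = x + h"
      have h: "z - x = 2 *\<^sub>R h" "y - x = h" by (simp_all add: h_def y_def)
      have "z - y = (z - x) - h" by (simp add: y_def)
      also have "\<dots> = h" by (simp add: h(1) scaleR_2)
      finally have h': "z - y = h" .
      have "norm h = norm (z - x) / 2" by (simp add: h_def)
      then have "norm h \<le> d" using zx norm_ge_zero[of "z - x"] by linarith
      then have "y \<in> cball x d" by (simp add: y_def dist_norm)
      then have y: "y \<in> X" using X(2)[OF x] by blast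
      have "u z - ?c y z \<le> ?w y" unfolding hopf_lax_def by (rule cSUP_upper[OF z(1) bdd[OF y]])
      moreover have "?w y - ?c x y \<le> hopf_lax X ?c ?w x" by (rule bw[OF xX y])
      moreover have "?c2 x z = ?c x y + ?c y z"
        using cost_scale[OF m(1), of 2 t h] by (simp add: h h')
      ultimately show "hopf_lax X ?c2 u x \<le> hopf_lax X ?c ?w x + e" using z(2) e'(2) by linarith
    qed
    moreover have "hopf_lax X (\<lambda>x y. ?c y x) (\<lambda>y. - ?w y) x \<le> - u x"
    proof (rule hopf_lax_le)
      fix y assume y: "y \<in> X"
      have "u x - ?c y x \<le> ?w y" unfolding hopf_lax_def by (rule cSUP_upper[OF xX bdd[OF y]])
      then show "- ?w y - ?c y x \<le> - u x" by simp
    qed (use xX in auto)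
    ultimately show "2 * ?w x \<le> hopf_lax X ?c ?w x - hopf_lax X (\<lambda>x y. ?c y x) (\<lambda>y. - ?w y) x"
      using conv by linarith
  qed
  ultimately show ?thesis using that by blast
qed

text \<open>This is where the empty interior of \<open>{H = 0}\<close> enters: that set is orthogonal to some
  direction \<open>e\<close>, so moving slowly along \<open>e\<close> costs little per unit of length.\<close>

lemma cost_slow:
  assumes e: "norm e = 1" "\<And>p. H p = 0 \<Longrightarrow> p \<bullet> e = 0" and "0 \<le> m" "0 < \<eta>"
  obtains s0 where "0 < s0" "\<And>s. 0 < s \<Longrightarrow> s < s0 \<Longrightarrow> cost m 1 (s *\<^sub>R e) \<le> s * \<eta>"
    "\<And>s. 0 < s \<Longrightarrow> s < s0 \<Longrightarrow> cost m 1 (- (s *\<^sub>R e)) \<le> s * \<eta>"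
proof -
  obtain R where R: "0 < R" "\<And>p. H p \<le> m \<Longrightarrow> norm p \<le> R" using cost_lipschitz[OF assms(3)] by metis
  \<comment> \<open>On \<open>A\<close> the Hamiltonian has a positive minimum, which outweighs the
    linear term for small speeds; off \<open>A\<close> the linear term itself is at most
    \<open>\<eta>\<close> per unit of speed.\<close>
  define A where "A = {p. H p \<le> m} \<inter> {p. \<eta> \<le> \<bar>p \<bullet> e\<bar>}"
  have "compact A" unfolding A_def
    by (intro compact_Int_closed compact_sublevel closed_Collect_le continuous_intros)
  have "\<exists>\<mu>>0. \<forall>p\<in>A. \<mu> \<le> H p"
  proof (cases "A = {}")
    case False
    then obtain q where q: "q \<in> A" "\<And>p. p \<in> A \<Longrightarrow> H q \<le> H p"
      using continuous_attains_inf[OF \<open>compact A\<close> _ cont'] by blast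
    have "H q \<noteq> 0" using q(1) e(2)[of q] assms(4) by (auto simp: A_def)
    with nonneg[of q] have "0 < H q" by simp
    with q(2) show ?thesis by blast
  qed (auto intro: zero_less_one)
  then obtain \<mu> where mu: "0 < \<mu>" "\<And>p. p \<in> A \<Longrightarrow> \<mu> \<le> H p" by blast
  have main: "cost m 1 (c *\<^sub>R e) \<le> \<bar>c\<bar> * \<eta>" if c: "\<bar>c\<bar> < \<mu> / R" for c
  proof (rule cost_le[OF assms(3)])
    fix p assume p: "H p \<le> m"
    have le: "p \<bullet> (c *\<^sub>R e) \<le> \<bar>c\<bar> * \<bar>p \<bullet> e\<bar>"
      by (metis abs_ge_self abs_mult inner_scaleR_right)
    show "p \<bullet> (c *\<^sub>R e) - 1 * H p \<le> \<bar>c\<bar> * \<eta>"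
    proof (cases "p \<in> A")
      case True
      have "\<bar>p \<bullet> e\<bar> \<le> R" using Cauchy_Schwarz_ineq2[of p e] R(2)[OF p] e(1) by simp
      then have "\<bar>c\<bar> * \<bar>p \<bullet> e\<bar> \<le> \<bar>c\<bar> * R" by (rule mult_left_mono) simp
      also have "\<dots> \<le> \<mu>" using c R(1) by (simp add: pos_less_divide_eq)
      finally have "p \<bullet> (c *\<^sub>R e) - 1 * H p \<le> 0" using le mu(2)[OF True] by simp
      also have "0 \<le> \<bar>c\<bar> * \<eta>" using assms(4) by simp
      finally show ?thesis .
    next
      case False
      then have "\<bar>c\<bar> * \<bar>p \<bullet> e\<bar> \<le> \<bar>c\<bar> * \<eta>" using p by (intro mult_left_mono) (auto simp: A_def)
      with le nonneg[of p] show ?thesis by simp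
    qed
  qed
  show ?thesis
  proof (rule that[of "\<mu> / R"])
    show "0 < \<mu> / R" using mu R by simp
    fix s :: real assume s: "0 < s" "s < \<mu> / R"
    show "cost m 1 (s *\<^sub>R e) \<le> s * \<eta>" using main[of s] s by simp
    show "cost m 1 (- (s *\<^sub>R e)) \<le> s * \<eta>" using main[of "- s"] s by simp
  qed
qed

text \<open>Drift along \<open>e\<close> until the coordinate \<open>x \<bullet> e\<close> would
  exceed its bound on \<open>X\<close>. Slower drift needs more steps, but each is cheaper in
  proportion to its length, so the total is governed by \<open>\<eta>\<close> alone.\<close>

lemma cheap_escape:
  assumes e: "norm e = 1" "\<And>p. H p = 0 \<Longrightarrow> p \<bullet> e = 0" and "0 \<le> m"
    and X: "bounded X" "\<And>x. x \<in> I \<Longrightarrow> cball x d \<subseteq> X" "0 < d" and "0 < t" "0 < \<epsilon>"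
  shows "\<exists>\<sigma> (k :: real ^ 'n \<Rightarrow> nat) N \<kappa>. 0 \<le> \<kappa> \<and> real N * \<kappa> < \<epsilon> \<and> (\<forall>x\<in>X. k x \<le> N)
      \<and> (\<forall>x\<in>I. \<sigma> x \<in> X \<and> k (\<sigma> x) < k x \<and> cost m t (\<sigma> x - x) + cost m t (x - \<sigma> x) \<le> \<kappa>)"
proof -
  obtain b where b: "0 < b" "\<And>x. x \<in> X \<Longrightarrow> norm x \<le> b" using X(1) unfolding bounded_pos by blast
  \<comment> \<open>The estimate below gives a total of at most
    \<open>(4 * b + 2 * d) * \<eta>\<close>: the first term from a path of length
    \<open>2 * b\<close> paid both ways, the second from rounding up the number of steps.\<close>
  define \<eta> where "\<eta> = \<epsilon> / (4 * b + 2 * d + 1)"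
  have "0 < 4 * b + 2 * d + 1" using b X(3) by simp
  then have eta: "0 < \<eta>" "\<eta> * (4 * b + 2 * d + 1) = \<epsilon>" using assms(8) by (auto simp: \<eta>_def)
  obtain s0 where s0: "0 < s0" "\<And>s. 0 < s \<Longrightarrow> s < s0 \<Longrightarrow> cost m 1 (s *\<^sub>R e) \<le> s * \<eta>"
    "\<And>s. 0 < s \<Longrightarrow> s < s0 \<Longrightarrow> cost m 1 (- (s *\<^sub>R e)) \<le> s * \<eta>"
    using cost_slow[OF e assms(3) eta(1)] by blast
  define s where "s = min (s0 / 2) (d / t)"
  have s: "0 < s" "s < s0" "s \<le> d / t" using s0(1) X(3) assms(7) by (auto simp: s_def)
  define r where "r = s * t"
  have r: "0 < r" "r \<le> d" using s assms(7) by (auto simp: r_def pos_le_divide_eq)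
  define \<sigma> where "\<sigma> x = x + r *\<^sub>R e" for x
  define k where "k x = nat \<lceil>(b - x \<bullet> e) / r\<rceil>" for x
  define N where "N = nat \<lceil>2 * b / r\<rceil>"
  define \<kappa> where "\<kappa> = 2 * (r * \<eta>)"
  have xe: "\<bar>x \<bullet> e\<bar> \<le> b" if "x \<in> X" for x
    using Cauchy_Schwarz_ineq2[of x e] b(2)[OF that] e(1) by simp
  have "real N \<le> 2 * b / r + 1" using b r by (simp add: N_def)
  then have "real N * \<kappa> \<le> (2 * b / r + 1) * \<kappa>" using r eta by (intro mult_right_mono) (auto simp: \<kappa>_def)
  also have "\<dots> = 4 * b * \<eta> + 2 * r * \<eta>" using r by (simp add: \<kappa>_def field_simps)
  also have "\<dots> \<le> 4 * b * \<eta> + 2 * d * \<eta>" using r eta by simp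
  also have "\<dots> < \<epsilon>" using eta by (simp add: algebra_simps)
  finally have 1: "real N * \<kappa> < \<epsilon>" .
  have 2: "k x \<le> N" if "x \<in> X" for x
    unfolding k_def N_def using xe[OF that] r
    by (intro nat_mono ceiling_mono divide_right_mono) auto
  have 3: "\<sigma> x \<in> X" if "x \<in> I" for x
  proof -
    have "\<sigma> x \<in> cball x d" using r e(1) by (simp add: \<sigma>_def dist_norm)
    with X(2)[OF that] show ?thesis by blast
  qed
  have 4: "k (\<sigma> x) < k x" if "x \<in> I" for x
  proof -
    have "(b - \<sigma> x \<bullet> e) / r = (b - x \<bullet> e) / r - 1"
      using r e(1) by (simp add: \<sigma>_def inner_add_left dot_square_norm field_simps)
    \<comment> \<open>Nonnegativity prevents \<open>nat\<close> from truncating both counts to 0, so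
      the count really drops.\<close>
    moreover have "0 \<le> (b - \<sigma> x \<bullet> e) / r" using xe[OF 3[OF that]] r by simp
    ultimately show ?thesis unfolding k_def by linarith
  qed
  have 5: "cost m t (\<sigma> x - x) + cost m t (x - \<sigma> x) \<le> \<kappa>" for x
  proof -
    have "cost m t (t *\<^sub>R z) = t * cost m 1 z" for z
      using cost_scale[OF assms(3,7), of 1 z] by simp
    from this[of "s *\<^sub>R e"] this[of "- (s *\<^sub>R e)"]
    have "cost m t (\<sigma> x - x) = t * cost m 1 (s *\<^sub>R e)" "cost m t (x - \<sigma> x) = t * cost m 1 (- (s *\<^sub>R e))"
      by (auto simp: \<sigma>_def r_def mult.commute)
    moreover have "t * cost m 1 (s *\<^sub>R e) \<le> t * (s * \<eta>)" "t * cost m 1 (- (s *\<^sub>R e)) \<le> t * (s * \<eta>)"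
      using assms(7) s0(2,3) s by (auto intro!: mult_left_mono)
    moreover have "\<kappa> = t * (s * \<eta>) + t * (s * \<eta>)" by (simp add: \<kappa>_def r_def algebra_simps)
    ultimately show ?thesis by linarith
  qed
  show ?thesis
    using 1 2 3 4 5 r eta
    by (intro exI[of _ \<sigma>] exI[of _ k] exI[of _ N] exI[of _ \<kappa>]) (auto simp: \<kappa>_def)
qed

end

section \<open>Comparison of sub- and superminimizers\<close>

theorem theorem2p1:
  fixes H :: "real ^ 'n \<Rightarrow> real"
    and U :: "(real ^ 'n) set"
    and u v :: "real ^ 'n \<Rightarrow> real"
  assumes "convex_on UNIV H"
    and "H 0 = 0" and "\<And>p. H p \<ge> 0"
    and "bounded {p. H p = 0}" and "interior {p. H p = 0} = {}"
    and "open U" and "bounded U"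
    and "continuous_on (closure U) u" and "continuous_on (closure U) v"
    and "absolutely_subminimizing H U u"
    and "absolutely_superminimizing H U v"
  shows "\<forall>x\<in>U. \<exists>y. is_arg_max (\<lambda>z. u z - v z) (\<lambda>z. z \<in> frontier U) y \<and>
           u x - v x \<le> u y - v y"
proof
  fix x0 assume x0: "x0 \<in> U"
  interpret h: hamiltonian H by unfold_locales (use assms in auto)
  interpret r: hamiltonian "\<lambda>p. H (- p)" by (rule hamiltonian_reflect) (rule h.hamiltonian_axioms)
  have "compact (closure U)" using assms(7) by simp
  have UN: "U \<noteq> UNIV" using assms(7) not_bounded_UNIV by blast
  then have "frontier U \<noteq> {}" using x0 frontier_not_empty by blast
  moreover have "compact (frontier U)" using assms(7) by (rule compact_frontier_bounded)
  moreover have uvc: "continuous_on (closure U) (\<lambda>z. u z - v z)"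
    using assms by (intro continuous_intros)
  moreover have "frontier U \<subseteq> closure U" by (simp add: frontier_def)
  ultimately obtain y where y: "y \<in> frontier U" "\<And>z. z \<in> frontier U \<Longrightarrow> u z - v z \<le> u y - v y"
    using continuous_attains_sup[of "frontier U" "\<lambda>z. u z - v z"] continuous_on_subset by metis
  have "u x0 - v x0 \<le> u y - v y"
  proof (rule ccontr)
    define M where "M = u y - v y"
    define g where "g = u x0 - v x0 - M"
    assume "\<not> u x0 - v x0 \<le> u y - v y"
    then have g: "0 < g" by (simp add: g_def M_def)
    \<comment> \<open>The threshold halfway between \<open>M\<close> and the value at
      \<open>x0\<close> makes this set compact inside \<open>U\<close> and leaves
      \<open>g / 2\<close> for the errors of the Hopf-Lax step.\<close>
    define A where "A = {x \<in> closure U. M + g / 2 \<le> u x - v x}"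
    have "closed A" unfolding A_def
      by (intro continuous_on_closed_Collect_le uvc continuous_on_const closed_closure)
    moreover have "A \<subseteq> closure U" by (auto simp: A_def)
    ultimately have "compact A" using \<open>compact (closure U)\<close> by (metis compact_Int_closed inf.absorb2)
    have AU: "A \<subseteq> U"
      using y(2) g assms(6) by (force simp: A_def M_def frontier_def interior_open)
    have "M + g / 2 \<le> u x0 - v x0" using g unfolding g_def by (simp add: field_simps)
    then have x0A: "x0 \<in> A" using x0 closure_subset[of U] by (auto simp: A_def)
    obtain d2 where d2: "0 < d2" "{x. infdist x A \<le> d2} \<subseteq> U"
      using compact_in_open_separated[OF _ \<open>compact A\<close> assms(6) AU] x0A by blast
    define d where "d = d2 / 2"
    have d: "0 < d" using d2 by (simp add: d_def)
    \<comment> \<open>Two layers at distances \<open>d\<close> and \<open>2 * d\<close> from the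
      complement: balls of radius \<open>d\<close> about \<open>I\<close> stay in \<open>X\<close>,
      and points of \<open>X\<close> outside \<open>I\<close> miss \<open>A\<close>, which supplies
      the boundary bound of the discrete comparison.\<close>
    define X where "X = {x. d \<le> infdist x (- U)}"
    define I where "I = {x. 2 * d \<le> infdist x (- U)}"
    have AI: "A \<subseteq> I"
    proof
      fix x assume x: "x \<in> A"
      have "d2 \<le> dist x z" if "z \<in> - U" for z
        using infdist_le[OF x, of z] d2(2) that by (force simp: dist_commute)
      moreover have "- U \<noteq> {}" using UN by auto
      ultimately have "d2 \<le> infdist x (- U)" by (subst infdist_notempty) (auto intro: cINF_greatest)
      then show "x \<in> I" by (simp add: I_def d_def)
    qed
    have infU: "x \<in> U" if "0 < infdist x (- U)" for x
      using that infdist_zero[of x "- U"] by (cases "x \<in> U") auto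
    have infU': "{x. b \<le> infdist x (- U)} \<subseteq> U" if "0 < b" for b
      using infU that by (blast intro: less_le_trans)
    then have XU: "X \<subseteq> U" using d by (simp add: X_def)
    have IX: "I \<subseteq> X" using d by (auto simp: I_def X_def)
    have ball: "cball x d \<subseteq> X" if "x \<in> I" for x
    proof
      fix z assume "z \<in> cball x d"
      then show "z \<in> X" using infdist_triangle_abs[of x "- U" z] that by (auto simp: I_def X_def)
    qed
    have bX: "bounded X" using XU assms(7) bounded_subset by blast
    define V where "V = {x. d / 2 < infdist x (- U)}"
    have "V \<lless> U"
    proof -
      have "open V" unfolding V_def by (intro open_Collect_less continuous_intros)
      moreover have "closure V \<subseteq> {x. d / 2 \<le> infdist x (- U)}"
        by (rule closure_minimal) (auto simp: V_def intro!: closed_Collect_le continuous_intros)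
      moreover have "{x. d / 2 \<le> infdist x (- U)} \<subseteq> U" by (rule infU') (use d in simp)
      moreover have "bounded V" by (rule bounded_subset[OF assms(7)]) (use calculation closure_subset[of V] in blast)
      ultimately show ?thesis by (auto simp: compactly_contained_def)
    qed
    have XV: "X \<subseteq> V" using d by (auto simp: X_def V_def)
    have "u \<in> Lip_loc U" "v \<in> Lip_loc U"
      using assms by (auto simp: absolutely_subminimizing_def absolutely_superminimizing_def)
    with \<open>V \<lless> U\<close> obtain K1 K2 where K12: "K1-lipschitz_on V u" "K2-lipschitz_on V v"
      by (fastforce simp: Lip_loc_def)
    define K where "K = max K1 K2"
    have K: "K-lipschitz_on X u" "K-lipschitz_on X v"
      using lipschitz_on_mono[OF K12(1) XV, of K] lipschitz_on_mono[OF K12(2) XV, of K] by (auto simp: K_def)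
    have K0: "0 \<le> K" using K(1) by (rule lipschitz_on_nonneg)
    have K': "K-lipschitz_on X (\<lambda>x. - v x)" using K(2) by (simp add: lipschitz_on_def dist_minus)
    have "bounded (H ` cball 0 (K + 1))"
      using compact_continuous_image[OF h.cont' compact_cball] compact_imp_bounded by blast
    then obtain l where "\<And>p. p \<in> cball 0 (K + 1) \<Longrightarrow> norm (H p) \<le> l" unfolding bounded_iff by blast
    then have l: "H p \<le> l" if "norm p \<le> K + 1" for p using that by force
    have l0: "0 \<le> l" using l[of 0] K0 h.H0 by simp
    define m where "m = l + 1"
    have m: "0 \<le> m" "l \<le> m" "l + 1 \<le> m" using l0 by (auto simp: m_def)
    obtain t1 where t1: "0 < t1" "\<And>t. 0 < t \<Longrightarrow> t < t1 \<Longrightarrow> discrete_subsolution X I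
        (\<lambda>x y. h.cost m t (y - x)) (hopf_lax X (\<lambda>x y. h.cost m t (y - x)) u)"
      using h.hopf_lax_subsolution[OF absolutely_subminimizing_segment_comparison[OF h.cont assms(10)]
          XU ball d K(1) l m(3)] by blast
    obtain t2 where t2: "0 < t2" "\<And>t. 0 < t \<Longrightarrow> t < t2 \<Longrightarrow> discrete_subsolution X I
        (\<lambda>x y. r.cost m t (y - x)) (hopf_lax X (\<lambda>x y. r.cost m t (y - x)) (\<lambda>x. - v x))"
      using r.hopf_lax_subsolution[OF absolutely_superminimizing_segment_comparison[OF h.cont assms(11)]
          XU ball d K' _ m(3)] l by auto
    \<comment> \<open>The last bound makes the total error \<open>2 * t * l\<close> of replacing
      \<open>u\<close> and \<open>v\<close> by \<open>w\<close> and \<open>z\<close> less than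
      \<open>g / 2\<close>.\<close>
    define t where "t = min (min (t1 / 2) (t2 / 2)) (g / (8 * (l + 1)))"
    have "t \<le> t1 / 2" "t \<le> t2 / 2" "t \<le> g / (8 * (l + 1))"
      unfolding t_def by (meson min.cobounded1 min.cobounded2 order_trans)+
    moreover have "0 < t" using t1(1) t2(1) g l0 by (simp add: t_def)
    ultimately have t: "0 < t" "t < t1" "t < t2" "t * (8 * (l + 1)) \<le> g"
      using l0 by (auto simp: pos_le_divide_eq)
    define c where "c = (\<lambda>x y. h.cost m t (y - x))"
    have rc: "(\<lambda>x y. r.cost m t (y - x)) = (\<lambda>x y. c y x)"
      by (simp add: c_def fun_eq_iff h.cost_reflect[OF m(1)])
    define w where "w = hopf_lax X c u"
    define z where "z x = - hopf_lax X (\<lambda>x y. c y x) (\<lambda>x. - v x) x" for x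
    have w: "u x \<le> w x" "w x \<le> u x + t * l" if "x \<in> X" for x
      using h.hopf_lax_bounds[OF K(1) _ m(2) less_imp_le[OF t(1)] that] l by (auto simp: w_def c_def)
    have z: "z x \<le> v x" "v x \<le> z x + t * l" if "x \<in> X" for x
      using r.hopf_lax_bounds[OF K' _ m(2) less_imp_le[OF t(1)] that] l by (auto simp: z_def rc)
    have bu: "bounded (u ` X)" and bv: "bounded (v ` X)"
      using K bX bounded_uniformly_continuous_image lipschitz_on_uniformly_continuous by blast+
    have bw: "bounded (w ` X)"
    proof -
      obtain B where "\<And>x. x \<in> X \<Longrightarrow> \<bar>u x\<bar> \<le> B" using bu by (auto simp: bounded_iff)
      then have "\<bar>w x\<bar> \<le> B + t * l" if "x \<in> X" for x
        using w[OF that] that t(1) l0 mult_nonneg_nonneg[of t l] by (fastforce simp: abs_le_iff)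
      then show ?thesis unfolding bounded_iff by auto
    qed
    have bz: "bounded (z ` X)"
    proof -
      obtain B where "\<And>x. x \<in> X \<Longrightarrow> \<bar>v x\<bar> \<le> B" using bv by (auto simp: bounded_iff)
      then have "\<bar>z x\<bar> \<le> B + t * l" if "x \<in> X" for x
        using z[OF that] that t(1) l0 mult_nonneg_nonneg[of t l] by (fastforce simp: abs_le_iff)
      then show ?thesis unfolding bounded_iff by auto
    qed
    have dw: "discrete_subsolution X I c w" using t1(2)[OF t(1,2)] by (simp add: w_def c_def)
    have dz: "discrete_subsolution X I (\<lambda>x y. c y x) (\<lambda>x. - z x)"
      using t2(2)[OF t(1,3)] by (simp add: z_def rc)
    obtain a b where ab: "a \<noteq> 0" "{p. H p = 0} \<subseteq> {p. a \<bullet> p = b}"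
      proof -
      have "{p. H p \<le> 0} = {p. H p = 0}" using h.nonneg by (auto intro: antisym)
      then have "convex {p. H p = 0}" using h.convex_sublevel[of 0] by simp
      from empty_interior_subset_hyperplane[OF this assms(5)] that show ?thesis by metis
    qed
    define e where "e = a /\<^sub>R norm a"
    have "b = 0" using subsetD[OF ab(2), of 0] h.H0 by simp
    then have e: "norm e = 1" "\<And>p. H p = 0 \<Longrightarrow> p \<bullet> e = 0"
      using ab by (auto simp: e_def inner_commute)
    have "w x0 - z x0 \<le> M + g / 2 + 2 * (t * l)"
    proof (rule discrete_comparison[where c = c, OF _ IX bw dw bz dz])
      show "0 \<le> c x y" for x y unfolding c_def by (rule h.cost_nonneg[OF m(1)])
      show "\<exists>\<sigma> (k :: real ^ 'n \<Rightarrow> nat) N \<kappa>. 0 \<le> \<kappa> \<and> real N * \<kappa> < \<epsilon> \<and> (\<forall>x\<in>X. k x \<le> N)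
          \<and> (\<forall>x\<in>I. \<sigma> x \<in> X \<and> k (\<sigma> x) < k x \<and> c x (\<sigma> x) + c (\<sigma> x) x \<le> \<kappa>)" if "0 < \<epsilon>" for \<epsilon>
        unfolding c_def by (rule h.cheap_escape[OF e m(1) bX ball d t(1) that])
      fix x assume x: "x \<in> X" "x \<notin> I"
      then have "u x - v x < M + g / 2"
        using AI XU closure_subset[of U] by (force simp: A_def)
      with w[OF x(1)] z[OF x(1)] show "w x - z x \<le> M + g / 2 + 2 * (t * l)" by linarith
    qed (use x0A AI IX in blast)
    moreover have "x0 \<in> X" using x0A AI IX by blast
    ultimately have "u x0 - v x0 \<le> M + g / 2 + 2 * (t * l)" using w(1) z(1) by fastforce
    moreover have "2 * (t * l) < g / 2" using t(1,4) g by (simp add: algebra_simps)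
    moreover have "u x0 - v x0 = M + g" by (simp add: g_def)
    ultimately show False by simp
  qed
  with y show "\<exists>y. is_arg_max (\<lambda>z. u z - v z) (\<lambda>z. z \<in> frontier U) y \<and> u x0 - v x0 \<le> u y - v y"
    by (intro exI[of _ y]) (auto simp: is_arg_max_linorder)
qed

end
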